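(* Let $\gamma$ be a probability measure on $\mathbb R^\infty$ such that $\gamma$-a.e. $\bar x=\{x_j\}_{j\in\mathbb N}$ is non-decreasing, and let $\bar g=\{g_j\}_{j\in\mathbb N}$ be a real sequence with $\sum_j g_j^2<\infty$. (i) Suppose $p=1-q\in[0,1/2)$ and for some $\chi>1/2$, $\gamma$ satisfies $$\sum_{k=1}^\infty\gamma\big(x_k\le k^\chi\big)<\infty .$$ Then there exists a strong solution to the infinite system of competing Brownian particles with parameters $p,\bar g$ and initial distribution $\gamma$. (ii) Suppose $p=1-q\in(1/2,1)$ and for some $c>0$, $\gamma$ satisfies $$\sum_{j=1}^\infty e^{-c(x_j\vee0)^2}<\infty\quad\gamma\text{-a.s.}$$ Then there exists a strong solution to the infinite system of competing Brownian particles with parameters $p,\bar g$ and initial distribution $\gamma$.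
   Context: Setting. $(\Omega,\mathcal F,\{\mathcal F_t\}_{t\ge0},\mathbb P)$ is a filtered probability space carrying independent standard one-dimensional ($\mathcal F_t$-adapted) Brownian motions $\{B_j\}_{j\in\mathbb N}$ such that $\{B_i(t+\cdot)-B_i(t),\,i\in\mathbb N\}$ is independent of $\mathcal F_t$ for all $t\ge0$, and $\bar x=\{x_j\}_{j\in\mathbb N}$ is a non-decreasing sequence of real $\mathcal F_0$-measurable random variables (initial conditions); the law of $\bar x$ is the initial distribution. An infinite system of competing Brownian particles (a solution) with parameters $p,\bar g$, initial conditions $\bar x$ and driving Brownian motions $\{B_j\}$ is a collection $\{X_j\}_{j\in\mathbb N}$ of continuous, real-valued, $\{\mathcal F_t\}$-adapted processes for which there are continuous, real-valued, $\{\mathcal F_t\}$-adapted processes $\{L_{(j,j+1)}\}_{j\ge0}$ (the associated local times) such that, with $q=1-p$: (P1) for all $t\ge0$, $j\in\mathbb N$: $X_j(t)=x_j+g_jt+B_j(t)+pL_{(j-1,j)}(t)-qL_{(j,j+1)}(t)$; (P2) for all $t\ge0$ the sequence $\{X_j(t)\}_{j\in\mathbb N}$ is non-decreasing; (P3) $L_{(0,1)}\equiv0$, and for $j\ge1$, $L_{(j,j+1)}$ is non-decreasing with $L_{(j,j+1)}(0)=0$ and $\int_0^\infty(X_{j+1}(t)-X_j(t))\,dL_{(j,j+1)}(t)=0$. There exists a strong solution with initial distribution $\gamma$ if, for every choice of a filtered probability space, Brownian motions $\{B_j\}$ and initial sequence $\bar x$ as in the setting, with $\bar x$ distributed as $\gamma$,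 there exist on that space continuous $\{\mathcal F_t\}$-adapted processes $\{X_j\}$ and $\{L_{(j,j+1)}\}$ satisfying (P1)-(P3). *)

theory Defs
  imports "HOL-Probability.Probability"
begin

text \<open>
  Time is a real number, and only times \<open>t \<ge> 0\<close> are ever constrained. Particles are indexed by
  \<open>j \<ge> 1\<close>; the value of a sequence at index \<open>0\<close> is irrelevant, except that \<open>L 0\<close> stands for
  the local time \<open>L\<^sub>(\<^sub>0\<^sub>,\<^sub>1\<^sub>)\<close>. Processes are written \<open>X j t \<omega>\<close>. No completeness of the filtration is
  assumed, so path properties (continuity, monotonicity, (P1)--(P3)) are required almost surely,
  simultaneously for all times and all indices.
\<close>

abbreviation real_sequences :: "(nat \<Rightarrow> real) measure" where
  "real_sequences \<equiv> PiM {1..} (\<lambda>_. borel)"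

definition standard_brownian_motion :: "'a measure \<Rightarrow> (real \<Rightarrow> 'a \<Rightarrow> real) \<Rightarrow> bool" where
  "standard_brownian_motion M W \<longleftrightarrow>
     prob_space M \<and>
     (\<forall>t\<ge>0. W t \<in> borel_measurable M) \<and>
     (AE \<omega> in M. W 0 \<omega> = 0 \<and> continuous_on {0..} (\<lambda>t. W t \<omega>)) \<and>
     (\<forall>\<tau> :: nat \<Rightarrow> real. 0 \<le> \<tau> 0 \<and> mono \<tau> \<longrightarrow>
        prob_space.indep_vars M (\<lambda>_. borel) (\<lambda>k \<omega>. W (\<tau> (Suc k)) \<omega> - W (\<tau> k) \<omega>) UNIV) \<and>
     (\<forall>s t. 0 \<le> s \<and> s < t \<longrightarrow>
        distributed M lborel (\<lambda>\<omega>. W t \<omega> - W s \<omega>) (normal_density 0 (sqrt (t - s))))"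

definition filtered_prob_space :: "'a measure \<Rightarrow> (real \<Rightarrow> 'a measure) \<Rightarrow> bool" where
  "filtered_prob_space M F \<longleftrightarrow>
     prob_space M \<and>
     (\<forall>t\<ge>0. subalgebra M (F t)) \<and>
     (\<forall>s t. 0 \<le> s \<and> s \<le> t \<longrightarrow> sets (F s) \<subseteq> sets (F t))"

definition adapted :: "(real \<Rightarrow> 'a measure) \<Rightarrow> (real \<Rightarrow> 'a \<Rightarrow> real) \<Rightarrow> bool" where
  "adapted F Y \<longleftrightarrow> (\<forall>t\<ge>0. Y t \<in> borel_measurable (F t))"

definition driving_brownian_motions ::
  "'a measure \<Rightarrow> (real \<Rightarrow> 'a measure) \<Rightarrow> (nat \<Rightarrow> real \<Rightarrow> 'a \<Rightarrow> real) \<Rightarrow> bool" where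
  "driving_brownian_motions M F B \<longleftrightarrow>
     (\<forall>j\<ge>1. standard_brownian_motion M (B j) \<and> adapted F (B j)) \<and>
     prob_space.indep_vars M (\<lambda>_. PiM {0..} (\<lambda>_. borel)) (\<lambda>j \<omega>. \<lambda>t\<in>{0..}. B j t \<omega>) {1..} \<and>
     (\<forall>t\<ge>0. prob_space.indep_set M (sets (F t))
        (sets (vimage_algebra (space M)
          (\<lambda>\<omega>. \<lambda>(i, s)\<in>{1..} \<times> {0..}. B i (t + s) \<omega> - B i t \<omega>)
          (PiM ({1..} \<times> {0..}) (\<lambda>_. borel)))))"

definition initial_sequence ::
  "'a measure \<Rightarrow> (real \<Rightarrow> 'a measure) \<Rightarrow> (nat \<Rightarrow> 'a \<Rightarrow> real) \<Rightarrow> bool" where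
  "initial_sequence M F x \<longleftrightarrow>
     (\<forall>j\<ge>1. x j \<in> borel_measurable (F 0)) \<and>
     (AE \<omega> in M. mono_on {1..} (\<lambda>j. x j \<omega>))"

definition has_initial_distribution ::
  "'a measure \<Rightarrow> (nat \<Rightarrow> 'a \<Rightarrow> real) \<Rightarrow> (nat \<Rightarrow> real) measure \<Rightarrow> bool" where
  "has_initial_distribution M x \<gamma> \<longleftrightarrow> distr M real_sequences (\<lambda>\<omega>. \<lambda>j\<in>{1..}. x j \<omega>) = \<gamma>"

text \<open>
  The integral in (P3) is with respect to the Lebesgue--Stieltjes measure on \<open>[0, \<infinity>)\<close> of the path
  \<open>t \<mapsto> L j t\<close>, which is frozen at its value at \<open>0\<close> for negative times so that it becomes a continuous
  non-decreasing function on the whole line. The integrand is nonnegative by (P2); the extended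
  nonnegative integral is used because a Bochner integral would be \<open>0\<close> also when it diverges.
\<close>

definition P1 ::
  "real \<Rightarrow> (nat \<Rightarrow> real) \<Rightarrow> (nat \<Rightarrow> real) \<Rightarrow> (nat \<Rightarrow> real \<Rightarrow> real) \<Rightarrow>
   (nat \<Rightarrow> real \<Rightarrow> real) \<Rightarrow> (nat \<Rightarrow> real \<Rightarrow> real) \<Rightarrow> bool" where
  "P1 p g x b X L \<longleftrightarrow>
     (\<forall>t\<ge>0. \<forall>j\<ge>1. X j t = x j + g j * t + b j t + p * L (j - 1) t - (1 - p) * L j t)"

definition P2 :: "(nat \<Rightarrow> real \<Rightarrow> real) \<Rightarrow> bool" where
  "P2 X \<longleftrightarrow> (\<forall>t\<ge>0. mono_on {1..} (\<lambda>j. X j t))"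

definition P3 :: "(nat \<Rightarrow> real \<Rightarrow> real) \<Rightarrow> (nat \<Rightarrow> real \<Rightarrow> real) \<Rightarrow> bool" where
  "P3 X L \<longleftrightarrow>
     (\<forall>t\<ge>0. L 0 t = 0) \<and>
     (\<forall>j\<ge>1. mono_on {0..} (L j) \<and> L j 0 = 0 \<and>
        (\<integral>\<^sup>+ t\<in>{0..}. ennreal (X (j + 1) t - X j t)
           \<partial>interval_measure (\<lambda>t. L j (max 0 t))) = 0)"

definition competing_brownian_particles ::
  "'a measure \<Rightarrow> (real \<Rightarrow> 'a measure) \<Rightarrow> real \<Rightarrow> (nat \<Rightarrow> real) \<Rightarrow> (nat \<Rightarrow> 'a \<Rightarrow> real) \<Rightarrow>
   (nat \<Rightarrow> real \<Rightarrow> 'a \<Rightarrow> real) \<Rightarrow> (nat \<Rightarrow> real \<Rightarrow> 'a \<Rightarrow> real) \<Rightarrow> bool" where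
  "competing_brownian_particles M F p g x B X \<longleftrightarrow>
     (\<forall>j\<ge>1. adapted F (X j)) \<and>
     (AE \<omega> in M. \<forall>j\<ge>1. continuous_on {0..} (\<lambda>t. X j t \<omega>)) \<and>
     (\<exists>L :: nat \<Rightarrow> real \<Rightarrow> 'a \<Rightarrow> real.
        (\<forall>j. adapted F (L j)) \<and>
        (AE \<omega> in M. \<forall>j. continuous_on {0..} (\<lambda>t. L j t \<omega>)) \<and>
        (AE \<omega> in M.
           P1 p g (\<lambda>j. x j \<omega>) (\<lambda>j t. B j t \<omega>) (\<lambda>j t. X j t \<omega>) (\<lambda>j t. L j t \<omega>) \<and>
           P2 (\<lambda>j t. X j t \<omega>) \<and>
           P3 (\<lambda>j t. X j t \<omega>) (\<lambda>j t. L j t \<omega>)))"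

text \<open>
  HOL cannot quantify over types inside a formula, so the type of the sample points is a parameter;
  a theorem concluding \<open>strong_solution_exists TYPE('a) p g \<gamma>\<close> for a type variable \<open>'a\<close> covers
  every choice of the probability space.
\<close>

definition strong_solution_exists ::
  "'a itself \<Rightarrow> real \<Rightarrow> (nat \<Rightarrow> real) \<Rightarrow> (nat \<Rightarrow> real) measure \<Rightarrow> bool" where
  "strong_solution_exists (_ :: 'a itself) p g \<gamma> \<longleftrightarrow>
     (\<forall>(M :: 'a measure) F B x.
        filtered_prob_space M F \<and> driving_brownian_motions M F B \<and>
        initial_sequence M F x \<and> has_initial_distribution M x \<gamma> \<longrightarrow>
        (\<exists>X. competing_brownian_particles M F p g x B X))"

end

theory Submission
  imports Defs "HOL-Real_Asymp.Real_Asymp"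
begin

text \<open>
  Write \<open>w\<^sub>j(t) = x\<^sub>j + g\<^sub>j t + B\<^sub>j(t)\<close> and \<open>q = 1 - p\<close>. By Skorokhod's reflection principle the local time
  \<open>L\<^sub>j\<close> has to be the running maximum of the positive part of
  \<open>w\<^sub>j - w\<^sub>j\<^sub>+\<^sub>1 + q L\<^sub>j\<^sub>+\<^sub>1 + p L\<^sub>j\<^sub>-\<^sub>1\<close>. The right-hand side is monotone in \<open>L\<close>, so iterating it from
  \<open>L = 0\<close> gives an increasing sequence of continuous processes (\<open>local_time_iter\<close>). This is done
  for the infinite system at once, path by path, and only countable suprema occur, so the limit
  \<open>local_time\<close> is adapted whatever the path looks like. Two things have to be shown for almost
  every path: the limit is finite, and it has no jumps. Everything else then follows from the fixed
  point equation.

  Jumps. An increasing limit of continuous non-decreasing functions is left-continuous. If \<open>J\<^sub>j\<close> is the right jump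
  of \<open>L\<^sub>j\<close> at some time, the fixed point equation gives \<open>J\<^sub>j \<le> q J\<^sub>j\<^sub>+\<^sub>1 + p J\<^sub>j\<^sub>-\<^sub>1\<close>, that is
  \<open>p (J\<^sub>j - J\<^sub>j\<^sub>-\<^sub>1) \<le> q (J\<^sub>j\<^sub>+\<^sub>1 - J\<^sub>j)\<close>. Since \<open>J\<^sub>0 = 0\<close>, the first non-zero jump forces all later
  increments of \<open>J\<close> to grow at least like powers of \<open>p/q\<close> (\<open>jump_growth\<close>); in particular all later
  jumps are non-zero. Moreover two neighbours whose common local time jumps stand at the same place
  right after the jump (\<open>jump_coalesce\<close>).

  Case \<open>p > 1/2\<close>. Almost surely \<open>\<bar>B\<^sub>j(t)\<bar> \<le> A j\<close> for all \<open>j\<close> and all \<open>t \<le> T\<close>, with a random \<open>A\<close>.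
  Hence the driving terms \<open>w\<^sub>j - w\<^sub>j\<^sub>+\<^sub>1\<close> are at most \<open>A' j\<close> on \<open>[0, T]\<close>, and a quadratic polynomial in \<open>j\<close>
  is then a supersolution of the fixed point equation. It bounds the whole iteration. So \<open>L\<close> is finite,
  and jumps grow at most quadratically in \<open>j\<close>, which contradicts their growth like \<open>(p/q)\<^sup>j\<close>.

  Case \<open>p < 1/2\<close>. The particles are compared with the one-sided system \<open>p = 0\<close>, which lies below them
  (\<open>iter_le_one_sided\<close>). In that system a particle only feels those above it, and the position of particle
  \<open>j\<close> is, for some \<open>n \<ge> j\<close>, the sum of \<open>x\<^sub>n\<close>, a drift term and a passage sum
  \<open>\<Sum>i\<le>n. B\<^sub>i(s\<^sub>i\<^sub>-\<^sub>1) - B\<^sub>i(s\<^sub>i)\<close> over a decreasing sequence of times, as in last passage percolation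
  (\<open>one_sided_passage\<close>). For large \<open>n\<close> all passage sums are at most \<open>n\<^sup>\<chi> / 2\<close> in absolute value
  (\<open>eventually_passage_bound\<close>): there are at most
  \<open>(n + 1)\<^sup>n\<^sup>+\<^sup>1\<close> decreasing sequences on a grid with \<open>n\<close> cells, each of the sums over them has Gaussian tails
  with variance at most \<open>T\<close>, and rounding the times to the grid costs little because Brownian motion
  oscillates little on short intervals; \<open>\<chi> > 1/2\<close> beats both the entropy of the sequences and the
  rounding. On the other hand \<open>x\<^sub>n > n\<^sup>\<chi>\<close> eventually, by the Borel-Cantelli lemma. Therefore the \<open>n\<close>-th
  particle is bounded below on \<open>[0, T]\<close> by a constant that tends to infinity with \<open>n\<close>. This makes the local times
  finite one after the other, and it excludes jumps, because after a jump infinitely many particles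
  would have to stand at or below one point.
\<close>

section \<open>Running maxima\<close>

text \<open>
  The supremum runs over rational fractions of the time interval, so it is a countable supremum that
  contains both endpoints. On continuous functions it is the usual running maximum of the positive
  part; on other functions it still depends measurably on the function.
\<close>
definition running_max :: "(real \<Rightarrow> real) \<Rightarrow> real \<Rightarrow> real" where
  "running_max f t = (SUP u\<in>\<rat> \<inter> {0..1}. max 0 (f (u * t)))"

lemma
  fixes f :: "real \<Rightarrow> real"
  assumes cont: "continuous_on {0..} f" and t: "0 \<le> t"
  shows running_max_attained: "\<exists>s\<in>{0..t}. running_max f t = max 0 (f s)"
    and running_max_upper: "\<And>s. s \<in> {0..t} \<Longrightarrow> max 0 (f s) \<le> running_max f t"
proof -
  define h where "h u = max 0 (f (u * t))" for u
  have ht: "continuous_on {0..1} h"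
    unfolding h_def using t
    by (intro continuous_intros continuous_on_compose2[OF cont]) auto
  obtain v where v: "v \<in> {0..1}" "\<And>u. u \<in> {0..1} \<Longrightarrow> h u \<le> h v"
    using continuous_attains_sup[OF compact_Icc _ ht] by auto
  have bdd: "bdd_above (h ` (\<rat> \<inter> {0..1}))"
    using v by (intro bdd_aboveI[of _ "h v"]) auto
  have dense: "closure (\<rat> \<inter> {0..1::real}) = {0..1}"
  proof -
    have "(\<Union>y\<in>{1::real} \<rightarrow> \<rat>. {y 1}) = (\<rat> :: real set)"
      by (force simp: Pi_def)
    then show ?thesis
      using closure_rationals_in_convex_set[of "{0..1::real}"] by (simp add: Int_commute)
  qed
  have up: "h u \<le> running_max f t" if "u \<in> {0..1}" for u
  proof (rule continuous_le_on_closure[where S = "\<rat> \<inter> {0..1}" and f = h])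
    show "continuous_on (closure (\<rat> \<inter> {0..1})) h" using ht dense by simp
    show "u \<in> closure (\<rat> \<inter> {0..1})" using that dense by simp
    show "h x \<le> running_max f t" if "x \<in> \<rat> \<inter> {0..1}" for x
      unfolding running_max_def h_def[symmetric] using that bdd by (rule cSUP_upper)
  qed
  have "running_max f t \<le> h v"
    unfolding running_max_def h_def[symmetric] using v by (intro cSUP_least) auto
  with up[OF v(1)] have "running_max f t = h v" by simp
  with v(1) t show "\<exists>s\<in>{0..t}. running_max f t = max 0 (f s)"
    by (intro bexI[of _ "v * t"]) (auto simp: h_def mult_left_le_one_le)
  show "max 0 (f s) \<le> running_max f t" if "s \<in> {0..t}" for s
  proof (cases "t = 0")
    case True
    with that up[of 0] show ?thesis by (simp add: h_def)
  next
    case False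
    with that t up[of "s / t"] show ?thesis by (simp add: h_def)
  qed
qed

lemma running_max_nonneg:
  assumes "continuous_on {0..} f" "0 \<le> t"
  shows "0 \<le> running_max f t"
  using running_max_attained[OF assms] by auto

lemma running_max_ge:
  assumes "continuous_on {0..} f" "0 \<le> s" "s \<le> t"
  shows "f s \<le> running_max f t"
  using running_max_upper[OF assms(1), of t s] assms by auto

lemma running_max_le:
  assumes "continuous_on {0..} f" "0 \<le> t" "0 \<le> K" "\<And>s. 0 \<le> s \<Longrightarrow> s \<le> t \<Longrightarrow> f s \<le> K"
  shows "running_max f t \<le> K"
  using running_max_attained[OF assms(1,2)] assms(3,4) by auto

lemma running_max_mono:
  assumes "continuous_on {0..} f" "continuous_on {0..} g" "0 \<le> s" "s \<le> t"
    "\<And>u. 0 \<le> u \<Longrightarrow> u \<le> s \<Longrightarrow> f u \<le> g u"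
  shows "running_max f s \<le> running_max g t"
proof (rule running_max_le[OF assms(1,3)])
  show "0 \<le> running_max g t"
    using assms(3,4) by (intro running_max_nonneg assms(2)) auto
  show "f u \<le> running_max g t" if "0 \<le> u" "u \<le> s" for u
    using assms(5)[OF that] running_max_ge[OF assms(2) that(1), of t] that assms(4) by linarith
qed

text \<open>
  A running maximum moves no faster than the function below it; this is where its continuity comes from.
\<close>
lemma running_max_increment:
  assumes "continuous_on {0..} f" "0 \<le> s" "s \<le> t"
  shows "\<exists>u\<in>{s..t}. running_max f t \<le> running_max f s + \<bar>f u - f s\<bar>"
proof -
  obtain u where u: "u \<in> {0..t}" "running_max f t = max 0 (f u)"
    using running_max_attained[of f t] assms by auto
  show ?thesis
  proof (cases "u \<le> s")
    case True
    then have "running_max f t \<le> running_max f s"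
      using u running_max_upper[OF assms(1,2), of u] by auto
    with assms show ?thesis by (intro bexI[of _ s]) auto
  next
    case False
    have "max 0 (f s) \<le> running_max f s"
      using running_max_upper[OF assms(1,2), of s] assms by auto
    with False u show ?thesis by (intro bexI[of _ u]) auto
  qed
qed

lemma continuous_running_max:
  assumes cont: "continuous_on {0..} f"
  shows "continuous_on {0..} (running_max f)"
proof (rule continuous_onI)
  fix t e :: real assume t: "t \<in> {0..}" and e: "0 < e"
  from cont t e obtain d where d: "d > 0"
    and fd: "\<And>s. s \<in> {0..} \<Longrightarrow> dist s t < d \<Longrightarrow> \<bar>f s - f t\<bar> < e / 2"
    unfolding continuous_on_iff dist_real_def by (metis half_gt_zero)
  show "\<exists>d>0. \<forall>s\<in>{0..}. dist s t < d \<longrightarrow> dist (running_max f s) (running_max f t) \<le> e"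
  proof (intro exI[of _ d] conjI ballI impI d)
    fix s :: real assume s: "s \<in> {0..}" "dist s t < d"
    consider "t \<le> s" | "s \<le> t" by linarith
    then show "dist (running_max f s) (running_max f t) \<le> e"
    proof cases
      case 1
      then obtain u where "u \<in> {t..s}" "running_max f s \<le> running_max f t + \<bar>f u - f t\<bar>"
        using running_max_increment[OF cont, of t s] t by auto
      moreover have "\<bar>f u - f t\<bar> < e / 2"
        using \<open>u \<in> {t..s}\<close> s t by (intro fd) (auto simp: dist_real_def)
      moreover have "running_max f t \<le> running_max f s"
        using 1 t by (intro running_max_mono cont) auto
      ultimately show ?thesis using e by (simp add: dist_real_def)
    next
      case 2
      then obtain u where "u \<in> {s..t}" "running_max f t \<le> running_max f s + \<bar>f u - f s\<bar>"
        using running_max_increment[OF cont, of s t] s by auto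
      moreover have "\<bar>f u - f t\<bar> < e / 2"
        using \<open>u \<in> {s..t}\<close> s t by (intro fd) (auto simp: dist_real_def)
      moreover have "\<bar>f s - f t\<bar> < e / 2" using s by (intro fd)
      moreover have "\<bar>f u - f s\<bar> \<le> \<bar>f u - f t\<bar> + \<bar>f s - f t\<bar>" by linarith
      moreover have "running_max f s \<le> running_max f t"
        using 2 s by (intro running_max_mono cont) auto
      ultimately show ?thesis using e by (simp add: dist_real_def)
    qed
  qed
qed

text \<open>
  The sample points at which a local time would be infinite form a null set of the whole space, but
  the null sets need not belong to the filtration. So they cannot be discarded, and suprema of
  unbounded sets have to be measurable as well.
\<close>
lemma borel_measurable_real_SUP:
  fixes f :: "'i \<Rightarrow> 'a \<Rightarrow> real"
  assumes "countable I" and meas: "\<And>i. i \<in> I \<Longrightarrow> f i \<in> borel_measurable M"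
  shows "(\<lambda>x. SUP i\<in>I. f i x) \<in> borel_measurable M"
proof (cases "I = {}")
  case True
  then show ?thesis by simp
next
  case False
  define S where "S x = (SUP i\<in>I. ereal (f i x))" for x
  have S: "S \<in> borel_measurable M"
    unfolding S_def using assms by (intro borel_measurable_SUP) auto
  \<comment> \<open>The supremum of a set of reals without upper bound is a junk value, but always the same one.\<close>
  have c: "Sup X = (LEAST z :: real. False)" if "\<not> bdd_above X" for X :: "real set"
    using that unfolding Sup_real_def bdd_above_def by meson
  have "(SUP i\<in>I. f i x) = (if S x = \<infinity> then (LEAST z. False) else real_of_ereal (S x))" for x
  proof (cases "bdd_above ((\<lambda>i. f i x) ` I)")
    case True
    then obtain K where K: "\<And>i. i \<in> I \<Longrightarrow> f i x \<le> K" by (auto simp: bdd_above_def)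
    obtain a where "a \<in> I" using False by auto
    then have "ereal (f a x) \<le> S x" unfolding S_def by (rule SUP_upper)
    moreover have "S x \<le> ereal K" unfolding S_def using K by (intro SUP_least) auto
    ultimately have "\<bar>S x\<bar> \<noteq> \<infinity>" by auto
    then have "S x = ereal (SUP i\<in>I. f i x)"
      unfolding S_def by (rule ereal_SUP[symmetric])
    then show ?thesis by simp
  next
    case unbdd: False
    have "S x = \<infinity>"
      unfolding S_def using unbdd
      by (intro SUP_PInfty) (auto simp: bdd_above_def not_le intro: less_imp_le)
    then show ?thesis using c[OF unbdd] by simp
  qed
  then have eq: "(\<lambda>x. SUP i\<in>I. f i x) = (\<lambda>x. if S x = \<infinity> then (LEAST z. False) else real_of_ereal (S x))"
    by (rule ext)
  show ?thesis unfolding eq using S by measurable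
qed

section \<open>The monotone iteration for the local times\<close>

text \<open>
  Each step applies the Skorokhod reflection map of every pair of neighbours to the local times
  of the previous step. The function \<open>w\<close> collects initial position, drift and noise of each particle.
\<close>
fun local_time_iter :: "real \<Rightarrow> (nat \<Rightarrow> real \<Rightarrow> real) \<Rightarrow> nat \<Rightarrow> nat \<Rightarrow> real \<Rightarrow> real" where
  "local_time_iter p w 0 j t = 0"
| "local_time_iter p w (Suc m) j t =
     (if j = 0 then 0
      else running_max (\<lambda>s. w j s - w (Suc j) s
             + (1 - p) * local_time_iter p w m (Suc j) s + p * local_time_iter p w m (j - 1) s) t)"

definition local_time :: "real \<Rightarrow> (nat \<Rightarrow> real \<Rightarrow> real) \<Rightarrow> nat \<Rightarrow> real \<Rightarrow> real" where
  "local_time p w j t = (SUP m. local_time_iter p w m j t)"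

locale competing_paths =
  fixes p :: real and w :: "nat \<Rightarrow> real \<Rightarrow> real"
  assumes p_nonneg: "0 \<le> p" and p_less: "p < 1"
    and cont: "\<And>j. 1 \<le> j \<Longrightarrow> continuous_on {0..} (w j)"
    and start: "\<And>j. 1 \<le> j \<Longrightarrow> w j 0 \<le> w (Suc j) 0"
begin

abbreviation "iter \<equiv> local_time_iter p w"

definition push :: "nat \<Rightarrow> nat \<Rightarrow> real \<Rightarrow> real" where
  "push m j s = w j s - w (Suc j) s + (1 - p) * iter m (Suc j) s + p * iter m (j - 1) s"

lemma iter_boundary [simp]: "iter m 0 t = 0"
  by (cases m) auto

lemma iter_Suc: "1 \<le> j \<Longrightarrow> iter (Suc m) j = running_max (push m j)"
  by (auto simp: push_def[abs_def])

declare local_time_iter.simps(2) [simp del]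

lemma continuous_iter: "continuous_on {0..} (iter m j)"
proof (induction m arbitrary: j)
  case 0
  then show ?case by simp
next
  case (Suc m)
  show ?case
  proof (cases "j = 0")
    case True
    then show ?thesis by simp
  next
    case False
    then have "continuous_on {0..} (push m j)"
      unfolding push_def[abs_def] by (intro continuous_intros cont Suc.IH) auto
    with False show ?thesis by (simp add: iter_Suc continuous_running_max)
  qed
qed

lemma continuous_push: "1 \<le> j \<Longrightarrow> continuous_on {0..} (push m j)"
  unfolding push_def[abs_def] by (intro continuous_intros cont continuous_iter) auto

lemma iter_nonneg: "0 \<le> t \<Longrightarrow> 0 \<le> iter m j t"
  by (cases m; cases "j = 0") (auto simp: iter_Suc intro!: running_max_nonneg continuous_push)

lemma iter_mono_time: "0 \<le> s \<Longrightarrow> s \<le> t \<Longrightarrow> iter m j s \<le> iter m j t"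
  by (cases m; cases "j = 0") (auto simp: iter_Suc intro!: running_max_mono continuous_push)

lemma iter_le_Suc: "0 \<le> t \<Longrightarrow> iter m j t \<le> iter (Suc m) j t"
proof (induction m arbitrary: j t)
  case 0
  then show ?case by (simp add: iter_nonneg)
next
  case (Suc m)
  show ?case
  proof (cases "j = 0")
    case True
    then show ?thesis by simp
  next
    case False
    have "push m j u \<le> push (Suc m) j u" if "0 \<le> u" for u
      unfolding push_def using p_nonneg p_less Suc.IH[OF that]
      by (intro add_mono mult_left_mono) auto
    with False Suc.prems show ?thesis
      by (simp add: iter_Suc running_max_mono continuous_push)
  qed
qed

lemma iter_incseq: "0 \<le> t \<Longrightarrow> incseq (\<lambda>m. iter m j t)"
  by (intro incseq_SucI iter_le_Suc)

lemma iter_at_0: "iter m j 0 = 0"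
proof (induction m arbitrary: j)
  case 0
  then show ?case by simp
next
  case (Suc m)
  show ?case
  proof (cases "j = 0")
    case True
    then show ?thesis by simp
  next
    case False
    then have "push m j 0 \<le> 0"
      using start[of j] by (simp add: push_def Suc.IH)
    then have "running_max (push m j) 0 \<le> 0"
      using False by (intro running_max_le continuous_push) (auto simp: antisym_conv)
    with False show ?thesis
      using iter_nonneg[of 0 "Suc m" j] by (simp add: iter_Suc)
  qed
qed

text \<open>
  The iteration starts below every nonnegative supersolution and the reflection map is monotone,
  so it stays below.
\<close>
lemma iter_le_supersolution:
  assumes pos: "\<And>j. 0 \<le> U j"
    and super: "\<And>j t. 1 \<le> j \<Longrightarrow> 0 \<le> t \<Longrightarrow> t \<le> T \<Longrightarrow>
      w j t - w (Suc j) t + (1 - p) * U (Suc j) + p * U (j - 1) \<le> U j"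
  shows "0 \<le> t \<Longrightarrow> t \<le> T \<Longrightarrow> iter m j t \<le> U j"
proof (induction m arbitrary: j t)
  case 0
  then show ?case by (simp add: pos)
next
  case (Suc m)
  show ?case
  proof (cases "j = 0")
    case True
    then show ?thesis by (simp add: pos)
  next
    case False
    have "push m j u \<le> U j" if "0 \<le> u" "u \<le> t" for u
    proof -
      have "(1 - p) * iter m (Suc j) u + p * iter m (j - 1) u \<le> (1 - p) * U (Suc j) + p * U (j - 1)"
        using p_nonneg p_less that Suc.prems
        by (intro add_mono mult_left_mono Suc.IH) auto
      with super[of j u] False that Suc.prems show ?thesis by (simp add: push_def)
    qed
    with False show ?thesis
      using Suc.prems pos by (auto simp: iter_Suc intro!: running_max_le continuous_push)
  qed
qed

end

text \<open>
  Finiteness of the limit is the only thing missing for the fixed point equation, which is expressed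
  below by \<open>push_le_L\<close> (the limit is large enough) and \<open>L_least\<close> (it is not larger than it has to be).
\<close>
locale bounded_competing_paths = competing_paths +
  assumes bounded: "\<And>j t. 0 \<le> t \<Longrightarrow> \<exists>K. \<forall>m. iter m j t \<le> K"
begin

abbreviation "L \<equiv> local_time p w"

definition X :: "nat \<Rightarrow> real \<Rightarrow> real" where
  "X j t = w j t + p * L (j - 1) t - (1 - p) * L j t"

lemma bdd_iter: "0 \<le> t \<Longrightarrow> bdd_above (range (\<lambda>m. iter m j t))"
  using bounded[of t j] by (auto simp: bdd_above_def)

lemma iter_le_L: "0 \<le> t \<Longrightarrow> iter m j t \<le> L j t"
  unfolding local_time_def by (intro cSUP_upper bdd_iter) auto

lemma iter_tendsto_L: "0 \<le> t \<Longrightarrow> (\<lambda>m. iter m j t) \<longlonglongrightarrow> L j t"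
  unfolding local_time_def by (intro LIMSEQ_incseq_SUP bdd_iter iter_incseq)

lemma L_le: "(\<And>m. iter m j t \<le> K) \<Longrightarrow> L j t \<le> K"
  unfolding local_time_def by (intro cSUP_least) auto

lemma L_boundary [simp]: "L 0 t = 0"
  by (simp add: local_time_def)

lemma L_at_0: "L j 0 = 0"
  by (simp add: local_time_def iter_at_0)

lemma L_nonneg: "0 \<le> t \<Longrightarrow> 0 \<le> L j t"
  using iter_le_L[of t 0 j] by simp

lemma L_mono: "0 \<le> s \<Longrightarrow> s \<le> t \<Longrightarrow> L j s \<le> L j t"
  by (intro L_le order_trans[OF iter_mono_time iter_le_L]) auto

lemma push_le_L:
  assumes "1 \<le> j" "0 \<le> t"
  shows "w j t - w (Suc j) t + (1 - p) * L (Suc j) t + p * L (j - 1) t \<le> L j t"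
proof (rule LIMSEQ_le_const2)
  show "(\<lambda>m. push m j t) \<longlonglongrightarrow> w j t - w (Suc j) t + (1 - p) * L (Suc j) t + p * L (j - 1) t"
    unfolding push_def by (intro tendsto_intros iter_tendsto_L assms)
  show "\<exists>N. \<forall>m\<ge>N. push m j t \<le> L j t"
    using assms running_max_ge[OF continuous_push, of j t t] iter_le_L[of t "Suc _" j]
    by (auto simp: iter_Suc intro!: exI[of _ 0] intro: order_trans)
qed

lemma L_least:
  assumes "1 \<le> j" "0 \<le> t" "0 \<le> K"
    and "\<And>s. 0 \<le> s \<Longrightarrow> s \<le> t \<Longrightarrow>
      w j s - w (Suc j) s + (1 - p) * L (Suc j) s + p * L (j - 1) s \<le> K"
  shows "L j t \<le> K"
proof (rule L_le)
  fix m
  show "iter m j t \<le> K"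
  proof (cases m)
    case 0
    then show ?thesis using assms by simp
  next
    case (Suc k)
    have "push k j s \<le> K" if "0 \<le> s" "s \<le> t" for s
    proof -
      have "(1 - p) * iter k (Suc j) s + p * iter k (j - 1) s
          \<le> (1 - p) * L (Suc j) s + p * L (j - 1) s"
        using p_nonneg p_less that by (intro add_mono mult_left_mono iter_le_L) auto
      with assms(4)[OF that] show ?thesis by (simp add: push_def)
    qed
    with Suc assms show ?thesis
      by (auto simp: iter_Suc intro!: running_max_le continuous_push)
  qed
qed

lemma X_ordered: "1 \<le> j \<Longrightarrow> 0 \<le> t \<Longrightarrow> X j t \<le> X (Suc j) t"
  using push_le_L[of j t] by (simp add: X_def algebra_simps)

section \<open>Jumps of the limiting local times\<close>

definition L_right :: "nat \<Rightarrow> real \<Rightarrow> real" where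
  "L_right j s = (INF t\<in>{s<..}. L j t)"

context
  fixes s :: real
  assumes s: "0 \<le> s"
begin

lemma L_le_L_right: "L j s \<le> L_right j s"
  unfolding L_right_def using s by (intro cINF_greatest L_mono) auto

lemma L_right_le: "s < t \<Longrightarrow> L_right j s \<le> L j t"
  unfolding L_right_def using s
  by (intro cINF_lower) (auto intro!: bdd_belowI[of _ "L j s"] L_mono)

lemma L_tendsto_L_right: "(L j \<longlongrightarrow> L_right j s) (at_right s)"
proof (rule order_tendstoI)
  fix a assume "a < L_right j s"
  then have "a < L j t" if "s < t" for t using L_right_le[OF that, of j] by simp
  then show "\<forall>\<^sub>F t in at_right s. a < L j t"
    by (auto simp: eventually_at_right_field intro!: exI[of _ "s + 1"])
next
  fix a assume "L_right j s < a"
  then obtain u where u: "s < u" "L j u < a"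
    unfolding L_right_def by (subst (asm) cINF_less_iff)
      (use s in \<open>auto intro!: bdd_belowI[of _ "L j s"] L_mono\<close>)
  then have "L j t < a" if "s < t" "t < u" for t
    using L_mono[of t u j] that s by simp
  with u show "\<forall>\<^sub>F t in at_right s. L j t < a"
    by (auto simp: eventually_at_right_field)
qed

text \<open>
  The fixed point equation passes to right limits: on a short interval to the right of \<open>s\<close> the running
  maximum is either still the one up to \<open>s\<close> or close to the right limit of its argument.
\<close>
lemma L_right_le_max:
  assumes j: "1 \<le> j"
  shows "L_right j s \<le> max (L j s)
    (w j s - w (Suc j) s + (1 - p) * L_right (Suc j) s + p * L_right (j - 1) s)" (is "_ \<le> max _ ?c")
proof (rule field_le_epsilon)
  fix e :: real assume e: "0 < e"
  let ?f = "\<lambda>u. w j u - w (Suc j) u + (1 - p) * L (Suc j) u + p * L (j - 1) u"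
  have w: "(w i \<longlongrightarrow> w i s) (at_right s)" if "1 \<le> i" for i
    using cont[OF that] s unfolding continuous_on_def
    by (rule_tac tendsto_within_subset[of _ _ _ "{0..}"]) auto
  have "(?f \<longlongrightarrow> ?c) (at_right s)"
    using j by (intro tendsto_intros L_tendsto_L_right w) auto
  then have "\<forall>\<^sub>F u in at_right s. ?f u < ?c + e"
    using e by (intro order_tendstoD) auto
  then obtain b where b: "s < b" "\<And>u. s < u \<Longrightarrow> u < b \<Longrightarrow> ?f u < ?c + e"
    by (auto simp: eventually_at_right_field)
  define t where "t = (s + b) / 2"
  have t: "s < t" "t < b" using b by (auto simp: t_def)
  have "?f u \<le> max (L j s) ?c + e" if "0 \<le> u" "u \<le> t" for u
  proof (cases "u \<le> s")
    case True
    then show ?thesis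
      using push_le_L[OF j that(1)] L_mono[of u s j] that e by linarith
  next
    case False
    then show ?thesis using b(2)[of u] that t by linarith
  qed
  moreover have "0 \<le> max (L j s) ?c + e" using L_nonneg[OF s, of j] e by linarith
  ultimately have "L j t \<le> max (L j s) ?c + e"
    using t s by (intro L_least j) auto
  then show "L_right j s \<le> max (L j s) ?c + e" using L_right_le[OF t(1), of j] by linarith
qed

definition jump :: "nat \<Rightarrow> real" where
  "jump j = L_right j s - L j s"

lemma jump_boundary [simp]: "jump 0 = 0"
  by (simp add: jump_def L_right_def)

lemma jump_nonneg: "0 \<le> jump j"
  using L_le_L_right[of j] by (simp add: jump_def)

text \<open>
  Jumps are subharmonic for the walk that steps up with probability \<open>q\<close> and down with
  probability \<open>p\<close>.
\<close>
lemma jump_increments: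
  assumes "1 \<le> j"
  shows "p * (jump j - jump (j - 1)) \<le> (1 - p) * (jump (Suc j) - jump j)"
proof -
  have "jump j \<le> max 0 ((1 - p) * jump (Suc j) + p * jump (j - 1))"
    using L_right_le_max[OF assms] push_le_L[OF assms s] by (auto simp: jump_def algebra_simps)
  moreover have "0 \<le> (1 - p) * jump (Suc j) + p * jump (j - 1)"
    using jump_nonneg p_nonneg p_less by simp
  ultimately show ?thesis by (simp add: algebra_simps)
qed

text \<open>
  Both sides are positions right after the jump: a local time jumps only as far as is needed to keep
  the two neighbours in order.
\<close>
lemma jump_coalesce:
  assumes "1 \<le> j" "0 < jump j"
  shows "w (Suc j) s + p * L_right j s - (1 - p) * L_right (Suc j) s
      \<le> w j s + p * L_right (j - 1) s - (1 - p) * L_right j s"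
  using L_right_le_max[OF assms(1)] assms(2) by (auto simp: jump_def algebra_simps)

text \<open>
  The increments of the jumps start with \<open>jump k\<close> itself, as \<open>jump (k - 1) = 0\<close>, and each of them is at
  least \<open>p / (1 - p)\<close> times the one before.
\<close>
lemma jump_growth:
  assumes "\<And>i. i < k \<Longrightarrow> jump i = 0" "1 \<le> k"
  shows "(p / (1 - p)) ^ n * jump k \<le> jump (k + n) - jump (k + n - 1)"
proof (induction n)
  case 0
  then show ?case using assms by simp
next
  case (Suc n)
  have "(p / (1 - p)) * ((p / (1 - p)) ^ n * jump k) \<le> (p / (1 - p)) * (jump (k + n) - jump (k + n - 1))"
    using p_nonneg p_less by (intro mult_left_mono Suc.IH) auto
  also have "\<dots> \<le> jump (Suc (k + n)) - jump (k + n)"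
    using jump_increments[of "k + n"] assms(2) p_less by (simp add: field_simps)
  finally show ?case by (simp add: mult.assoc)
qed

end

lemma first_jump:
  assumes s: "0 \<le> s" and j: "jump s j \<noteq> 0"
  obtains k where "1 \<le> k" "0 < jump s k" "\<And>i. i < k \<Longrightarrow> jump s i = 0"
proof
  let ?k = "LEAST k. jump s k \<noteq> 0"
  have k: "jump s ?k \<noteq> 0" using j by (rule LeastI)
  then show "0 < jump s ?k" using jump_nonneg[OF s, of ?k] by linarith
  show "1 \<le> ?k"
  proof (rule ccontr)
    assume "\<not> 1 \<le> ?k"
    then have "?k = 0" by linarith
    with k jump_boundary[OF s] show False by metis
  qed
  show "jump s i = 0" if "i < ?k" for i using not_less_Least[OF that] by blast
qed

lemma w_tendsto_right: "1 \<le> i \<Longrightarrow> 0 \<le> s \<Longrightarrow> (w i \<longlongrightarrow> w i s) (at_right s)"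
  using cont[of i] unfolding continuous_on_def
  by (rule_tac tendsto_within_subset[of _ _ _ "{0..}"]) auto

text \<open>
  Lower semicontinuity comes for free from the increasing continuous approximation, and for a monotone
  function absence of right jumps supplies the other half.
\<close>
lemma continuous_L:
  assumes right: "\<And>s. 0 \<le> s \<Longrightarrow> jump s j = 0"
  shows "continuous_on {0..} (L j)"
  unfolding continuous_on_def
proof (intro ballI order_tendstoI)
  fix s a :: real assume s: "s \<in> {0..}" and a: "a < L j s"
  then have "\<forall>\<^sub>F m in sequentially. a < iter m j s"
    using iter_tendsto_L[of s j] by (intro order_tendstoD) auto
  then obtain m where m: "a < iter m j s" by (auto simp: eventually_sequentially)
  have "(iter m j \<longlongrightarrow> iter m j s) (at s within {0..})"
    using continuous_iter[of m j] s by (auto simp: continuous_on_def)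
  then have "\<forall>\<^sub>F t in at s within {0..}. a < iter m j t"
    using m by (rule order_tendstoD)
  moreover have "\<forall>\<^sub>F t in at s within {0..}. t \<in> {0..}"
    by (simp add: eventually_at_filter)
  ultimately show "\<forall>\<^sub>F t in at s within {0..}. a < L j t"
    by eventually_elim (use iter_le_L in \<open>force intro: less_le_trans\<close>)
next
  fix s a :: real assume s: "s \<in> {0..}" and a: "L j s < a"
  then have "\<forall>\<^sub>F t in at_right s. L j t < a"
    using L_tendsto_L_right[of s j] right[of s] by (intro order_tendstoD) (auto simp: jump_def)
  then obtain b where b: "s < b" "\<And>t. s < t \<Longrightarrow> t < b \<Longrightarrow> L j t < a"
    by (auto simp: eventually_at_right_field)
  have "\<forall>\<^sub>F t in at s within {0..}. t < b"
    using b(1) by (intro order_tendstoD[OF tendsto_ident_at]) auto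
  moreover have "\<forall>\<^sub>F t in at s within {0..}. t \<in> {0..}"
    by (simp add: eventually_at_filter)
  ultimately show "\<forall>\<^sub>F t in at s within {0..}. L j t < a"
  proof eventually_elim
    case (elim t)
    then show ?case
      using b(2)[of t] L_mono[of t s j] a s by (cases "s < t") auto
  qed
qed

end

section \<open>Solutions from continuous local times\<close>

locale solvable_competing_paths = bounded_competing_paths +
  assumes no_jump: "\<And>j s. 0 \<le> s \<Longrightarrow> jump s j = 0"
begin

lemma continuous_X: "1 \<le> j \<Longrightarrow> continuous_on {0..} (X j)"
  unfolding X_def[abs_def] by (intro continuous_intros cont continuous_L no_jump) auto

lemma L_eq_running_max:
  assumes "1 \<le> j" "0 \<le> t"
  shows "L j t = running_max (\<lambda>s. L j s - (X (Suc j) s - X j s)) t"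
proof -
  have push: "L j s - (X (Suc j) s - X j s)
      = w j s - w (Suc j) s + (1 - p) * L (Suc j) s + p * L (j - 1) s" for s
    by (simp add: X_def algebra_simps)
  have c: "continuous_on {0..} (\<lambda>s. L j s - (X (Suc j) s - X j s))"
    using assms by (intro continuous_intros continuous_X continuous_L no_jump) auto
  show ?thesis
  proof (rule antisym)
    show "L j t \<le> running_max (\<lambda>s. L j s - (X (Suc j) s - X j s)) t"
      using running_max_ge[OF c] running_max_nonneg[OF c] assms
      by (intro L_least) (auto simp: push)
    show "running_max (\<lambda>s. L j s - (X (Suc j) s - X j s)) t \<le> L j t"
    proof (rule running_max_le[OF c assms(2) L_nonneg[OF assms(2)]])
      fix s assume "0 \<le> s" "s \<le> t"
      then show "L j s - (X (Suc j) s - X j s) \<le> L j t"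
        using X_ordered[OF assms(1), of s] L_mono[of s t j] by linarith
    qed
  qed
qed

text \<open>
  The maximum that defines \<open>L j b\<close> is attained at some time, and at a time when the particles are apart
  the maximised function is strictly below \<open>L\<close>. So it is attained before \<open>a\<close>.
\<close>
lemma L_constant_off_collisions:
  assumes j: "1 \<le> j" and ab: "0 \<le> a" "a \<le> b"
    and apart: "\<And>s. a < s \<Longrightarrow> s \<le> b \<Longrightarrow> X j s < X (Suc j) s"
  shows "L j b = L j a"
proof (rule antisym)
  have "continuous_on {0..} (\<lambda>s. L j s - (X (Suc j) s - X j s))"
    using j by (intro continuous_intros continuous_X continuous_L no_jump) auto
  then obtain u where u: "u \<in> {0..b}" "L j b = max 0 (L j u - (X (Suc j) u - X j u))"
    using running_max_attained[of _ b] L_eq_running_max[OF j, of b] ab by fastforce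
  show "L j b \<le> L j a"
  proof (cases "u \<le> a")
    case True
    then show ?thesis
      using u L_mono[of u a j] X_ordered[OF j, of u] L_nonneg[OF ab(1), of j] by auto
  next
    case False
    then show ?thesis
      using u L_mono[of u b j] apart[of u] L_nonneg[OF ab(1), of j] by (auto simp: max_def split: if_splits)
  qed
qed (use L_mono ab in auto)

text \<open>
  The times at which the two particles are apart are covered by countably many intervals
  \<open>(a, b]\<close> with rational endpoints on which the local time is constant.
\<close>
lemma no_push_off_collisions:
  assumes j: "1 \<le> j"
  shows "(\<integral>\<^sup>+ t\<in>{0..}. ennreal (X (j + 1) t - X j t) \<partial>interval_measure (\<lambda>t. L j (max 0 t))) = 0"
proof -
  define F where "F t = L j (max 0 t)" for t
  define I where "I = {(a, b). a \<in> \<rat> \<and> b \<in> \<rat> \<and> a \<le> b \<and> F a = F b}"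
  have contF: "continuous_on UNIV F"
    unfolding F_def
    by (rule continuous_on_compose2[OF continuous_L[OF no_jump]]) (auto intro!: continuous_intros)
  have monoF: "F x \<le> F y" if "x \<le> y" for x y
    unfolding F_def using that by (intro L_mono) auto
  have null: "{a<..b} \<in> null_sets (interval_measure F)" if "(a, b) \<in> I" for a b
  proof (rule null_setsI)
    have "emeasure (interval_measure F) {a<..b} = F b - F a"
      using that contF monoF
      by (intro emeasure_interval_measure_Ioc)
         (auto simp: I_def continuous_on_eq_continuous_within intro: continuous_within_subset)
    then show "emeasure (interval_measure F) {a<..b} = 0" using that by (simp add: I_def)
  qed simp
  have "countable I"
    by (rule countable_subset[of _ "\<rat> \<times> \<rat>"]) (auto simp: I_def countable_rat)
  then have N: "(\<Union>(a, b)\<in>I. {a<..b}) \<in> null_sets (interval_measure F)"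
    using null by (intro null_sets_UN') auto
  \<comment> \<open>At time \<open>0\<close> an interval of negative times serves, as the integrator is constant there.\<close>
  have cover: "\<exists>i\<in>I. t \<in> (case i of (a, b) \<Rightarrow> {a<..b})" if "0 \<le> t" "X j t < X (Suc j) t" for t
  proof (cases "t = 0")
    case True
    have "(-1, 0) \<in> I" by (auto simp: I_def F_def)
    with True show ?thesis by force
  next
    case False
    have "continuous_on {0..} (\<lambda>t. X (Suc j) t - X j t)"
      using j by (intro continuous_intros continuous_X) auto
    then have "((\<lambda>t. X (Suc j) t - X j t) \<longlongrightarrow> X (Suc j) t - X j t) (at t within {0..})"
      using that by (auto simp: continuous_on_def)
    then have "\<forall>\<^sub>F u in at t within {0..}. 0 < X (Suc j) u - X j u"
      using that by (intro order_tendstoD) auto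
    then obtain d where d: "d > 0"
      "\<And>u. 0 \<le> u \<Longrightarrow> u \<noteq> t \<Longrightarrow> dist u t < d \<Longrightarrow> 0 < X (Suc j) u - X j u"
      by (auto simp: eventually_at)
    have "max 0 (t - d) < t" using False that d by simp
    then obtain a where a: "a \<in> \<rat>" "max 0 (t - d) < a" "a < t"
      using Rats_dense_in_real[of "max 0 (t - d)" t] by blast
    obtain b where b: "b \<in> \<rat>" "t < b" "b < t + d"
      using Rats_dense_in_real[of t "t + d"] d by auto
    have "X j u < X (Suc j) u" if "a < u" "u \<le> b" for u
      using d(2)[of u] that a b \<open>X j t < X (Suc j) t\<close>
      by (cases "u = t") (auto simp: dist_real_def abs_less_iff)
    then have "L j b = L j a"
      using a b by (intro L_constant_off_collisions j) auto
    then have "(a, b) \<in> I" using a b by (auto simp: I_def F_def)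
    with a b show ?thesis by (intro bexI[of _ "(a, b)"]) auto
  qed
  have "AE t in interval_measure F. ennreal (X (j + 1) t - X j t) * indicator {0..} t = 0"
  proof (rule AE_I'[OF N], safe)
    fix t assume "ennreal (X (j + 1) t - X j t) * indicator {0..} t \<noteq> 0"
    then have "0 \<le> t" "X j t < X (Suc j) t"
      by (auto simp: indicator_def ennreal_eq_0_iff split: if_splits)
    then show "t \<in> (\<Union>(a, b)\<in>I. {a<..b})" using cover by auto
  qed
  then have "(\<integral>\<^sup>+ t\<in>{0..}. ennreal (X (j + 1) t - X j t) \<partial>interval_measure F)
      = (\<integral>\<^sup>+ t. 0 \<partial>interval_measure F)"
    by (rule nn_integral_cong_AE)
  then show ?thesis by (simp add: F_def[abs_def])
qed

lemma X_P2: "P2 X"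
  unfolding P2_def
proof (intro allI impI mono_onI)
  fix t :: real and i j :: nat
  assume t: "0 \<le> t" and i: "i \<in> {1..}" and ij: "i \<le> j"
  show "X i t \<le> X j t"
    using ij by (induction rule: dec_induct) (use X_ordered t i in \<open>auto intro: order_trans\<close>)
qed

lemma X_P3: "P3 X L"
  unfolding P3_def using no_push_off_collisions
  by (auto intro!: mono_onI L_mono simp: L_at_0)

end

section \<open>Particles that are pushed up more than down\<close>

context competing_paths
begin

text \<open>
  On \<open>U\<^sub>j = \<beta> j\<^sup>2 + \<alpha> j\<close> the operator \<open>U\<^sub>j - q U\<^sub>j\<^sub>+\<^sub>1 - p U\<^sub>j\<^sub>-\<^sub>1\<close> takes the value
  \<open>(2 p - 1) (2 \<beta> j + \<alpha>) - \<beta>\<close>, and \<open>\<alpha>\<close> is chosen to leave only the linear term. This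
  needs the drift \<open>2 p - 1\<close> to be positive.
\<close>
lemma linear_gap_bound:
  assumes p: "1 / 2 < p" and A: "0 \<le> A"
    and gap: "\<And>j t. 1 \<le> j \<Longrightarrow> 0 \<le> t \<Longrightarrow> t \<le> T \<Longrightarrow> w j t - w (Suc j) t \<le> A * real j"
  shows "\<exists>\<beta>\<ge>0. \<forall>m j t. 0 \<le> t \<longrightarrow> t \<le> T \<longrightarrow> iter m j t \<le> \<beta> * (real j)\<^sup>2 + \<beta> / (2 * p - 1) * real j"
proof -
  define \<beta> where "\<beta> = A / (2 * (2 * p - 1))"
  define \<alpha> where "\<alpha> = \<beta> / (2 * p - 1)"
  define U where "U j = \<beta> * (real j)\<^sup>2 + \<alpha> * real j" for j
  have "iter m j t \<le> U j" if "0 \<le> t" "t \<le> T" for m j t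
  proof (rule iter_le_supersolution[OF _ _ that])
    show "0 \<le> U j" for j using p A by (simp add: U_def \<alpha>_def \<beta>_def)
    fix i :: nat and s assume i: "1 \<le> i" and s: "0 \<le> s" "s \<le> T"
    obtain k where k: "i = Suc k" using i by (cases i) auto
    have "(1 - p) * U (Suc i) + p * U (i - 1)
        = U i - 2 * \<beta> * (2 * p - 1) * real i - (\<alpha> * (2 * p - 1) - \<beta>)"
      unfolding U_def k by (simp add: algebra_simps power2_eq_square)
    also have "\<dots> = U i - A * real i"
    proof -
      have "2 * \<beta> * (2 * p - 1) = A" "\<alpha> * (2 * p - 1) = \<beta>"
        unfolding \<alpha>_def \<beta>_def using nonzero_mult_div_cancel_left[of "2 * (2 * p - 1)" A] p
        by (auto simp: mult_ac)
      then show ?thesis by simp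
    qed
    finally have "(1 - p) * U (Suc i) + p * U (i - 1) = U i - A * real i" .
    with gap[OF i s] show "w i s - w (Suc i) s + (1 - p) * U (Suc i) + p * U (i - 1) \<le> U i"
      by simp
  qed
  moreover have "0 \<le> \<beta>" using p A by (simp add: \<beta>_def)
  ultimately show ?thesis unfolding U_def \<alpha>_def by blast
qed

end

lemma solvable_if_linear_gaps:
  assumes "competing_paths p w" and p: "1 / 2 < p"
    and gap: "\<And>T. 0 \<le> T \<Longrightarrow>
      \<exists>A\<ge>0. \<forall>j\<ge>1. \<forall>t. 0 \<le> t \<longrightarrow> t \<le> T \<longrightarrow> w j t - w (Suc j) t \<le> A * real j"
  shows "solvable_competing_paths p w"
proof -
  interpret competing_paths p w by fact
  have bound: "\<exists>\<beta>\<ge>0. \<forall>m j t. 0 \<le> t \<longrightarrow> t \<le> T \<longrightarrow>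
      iter m j t \<le> \<beta> * (real j)\<^sup>2 + \<beta> / (2 * p - 1) * real j" if "0 \<le> T" for T
    using gap[OF that] linear_gap_bound[OF p, of _ T] by blast
  interpret bounded_competing_paths p w
  proof
    fix j and t :: real assume t: "0 \<le> t"
    then show "\<exists>K. \<forall>m. iter m j t \<le> K" using bound[OF t] t by blast
  qed
  show ?thesis
  proof
    fix j s assume s: "(0::real) \<le> s"
    show "jump s j = 0"
    proof (rule ccontr)
      assume "jump s j \<noteq> 0"
      then obtain k where k: "1 \<le> k" "0 < jump s k" "\<And>i. i < k \<Longrightarrow> jump s i = 0"
        using first_jump[OF s] by blast
      obtain \<beta> where \<beta>: "\<beta> \<ge> 0" "\<And>m j t. 0 \<le> t \<Longrightarrow> t \<le> s + 1 \<Longrightarrow>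
          iter m j t \<le> \<beta> * (real j)\<^sup>2 + \<beta> / (2 * p - 1) * real j"
        using bound[of "s + 1"] s by auto
      have upper: "jump s i \<le> \<beta> * (real i)\<^sup>2 + \<beta> / (2 * p - 1) * real i" for i
      proof -
        have "L i (s + 1) \<le> \<beta> * (real i)\<^sup>2 + \<beta> / (2 * p - 1) * real i"
          using s by (intro L_le \<beta>) auto
        then show ?thesis
          using L_right_le[OF s, of "s + 1" i] L_nonneg[OF s, of i] jump_def[OF s, of i] by simp
      qed
      \<comment> \<open>Jumps are bounded by a polynomial in the index and at the same time grow exponentially.\<close>
      have lower: "(p / (1 - p)) ^ n * jump s k
          \<le> \<beta> * (real (k + n))\<^sup>2 + \<beta> / (2 * p - 1) * real (k + n)" for n
        using jump_growth[OF s k(3) k(1), of n] upper[of "k + n"] jump_nonneg[OF s, of "k + n - 1"]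
        by linarith
      define \<rho> where "\<rho> = p / (1 - p)"
      have \<rho>: "1 < \<rho>" using p p_less by (simp add: \<rho>_def field_simps)
      define \<alpha> where "\<alpha> = \<beta> / (2 * p - 1)"
      have "(\<lambda>n. (\<beta> * (real (k + n))\<^sup>2 + \<alpha> * real (k + n)) / \<rho> ^ n) \<longlonglongrightarrow> 0"
      proof -
        have "(\<lambda>n. (real n)\<^sup>2 / \<rho> ^ n) \<longlonglongrightarrow> 0" "(\<lambda>n. real n / \<rho> ^ n) \<longlonglongrightarrow> 0"
          "(\<lambda>n. 1 / \<rho> ^ n) \<longlonglongrightarrow> 0"
          using \<rho> by real_asymp+
        then have "(\<lambda>n. \<beta> * ((real n)\<^sup>2 / \<rho> ^ n) + (2 * \<beta> * k + \<alpha>) * (real n / \<rho> ^ n)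
            + (\<beta> * (real k)\<^sup>2 + \<alpha> * k) * (1 / \<rho> ^ n)) \<longlonglongrightarrow> \<beta> * 0 + (2 * \<beta> * k + \<alpha>) * 0
              + (\<beta> * (real k)\<^sup>2 + \<alpha> * k) * 0"
          by (intro tendsto_intros)
        moreover have "(\<beta> * (real (k + n))\<^sup>2 + \<alpha> * real (k + n)) / \<rho> ^ n
            = \<beta> * ((real n)\<^sup>2 / \<rho> ^ n) + (2 * \<beta> * k + \<alpha>) * (real n / \<rho> ^ n)
            + (\<beta> * (real k)\<^sup>2 + \<alpha> * k) * (1 / \<rho> ^ n)" for n
          by (simp add: add_divide_distrib algebra_simps power2_eq_square)
        ultimately show ?thesis by simp
      qed
      then have "jump s k \<le> 0"
      proof (rule LIMSEQ_le_const)
        show "\<exists>N. \<forall>n\<ge>N. jump s k \<le> (\<beta> * (real (k + n))\<^sup>2 + \<alpha> * real (k + n)) / \<rho> ^ n"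
          using lower \<rho> unfolding \<rho>_def[symmetric] \<alpha>_def[symmetric]
          by (auto simp: pos_le_divide_eq mult.commute)
      qed
      with k(2) show False by simp
    qed
  qed
qed

section \<open>Particles that are pushed down more than up\<close>

context competing_paths
begin

text \<open>
  Equivalently, \<open>w n + p iter m (n - 1) - (1 - p) iter m n\<close>, the position of particle \<open>n\<close> after \<open>m\<close> steps,
  is at least its position in the system with \<open>p = 0\<close>. Comparing positions rather than local times is
  what gives an inequality that survives the induction.
\<close>
lemma iter_le_one_sided:
  assumes "1 \<le> n" "0 \<le> t"
  shows "(1 - p) * iter m n t \<le> local_time_iter 0 w m n t + p * iter m (n - 1) t"
  using assms
proof (induction m arbitrary: n t)
  case 0
  then show ?case by simp
next
  case (Suc m)
  interpret V: competing_paths 0 w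
    by unfold_locales (use cont start in auto)
  obtain s where s: "s \<in> {0..t}" "iter (Suc m) n t = max 0 (push m n s)"
    using running_max_attained[OF continuous_push, of n t m] Suc.prems by (auto simp: iter_Suc)
  have nonneg: "0 \<le> V.iter (Suc m) n t + p * iter (Suc m) (n - 1) t"
    using Suc.prems p_nonneg V.iter_nonneg iter_nonneg by simp
  have "(1 - p) * push m n s \<le> V.iter (Suc m) n t + p * iter (Suc m) (n - 1) t"
  proof -
    have 1: "(1 - p) * iter m (Suc n) s \<le> V.iter m (Suc n) s + p * iter m n s"
      using Suc.IH[of "Suc n" s] s by simp
    have 2: "(1 - p) * iter m n s \<le> V.iter m n s + p * iter m (n - 1) s"
      using Suc.IH[of n s] s Suc.prems by simp
    have 3: "w n s - w (Suc n) s + V.iter m (Suc n) s \<le> V.iter (Suc m) n t"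
      using running_max_ge[OF V.continuous_push, of n s t m] s Suc.prems
      by (simp add: V.iter_Suc V.push_def)
    have 4: "V.iter m n s \<le> V.iter (Suc m) n t"
      using V.iter_le_Suc[of s m n] V.iter_mono_time[of s t "Suc m" n] s by simp
    have 5: "iter m (n - 1) s \<le> iter (Suc m) (n - 1) t"
      using iter_le_Suc[of s m "n - 1"] iter_mono_time[of s t "Suc m" "n - 1"] s by simp
    have "(1 - p) * push m n s
        \<le> (1 - p) * (V.iter (Suc m) n t + p * iter m n s + p * iter m (n - 1) s)"
      using 1 3 p_less by (intro mult_left_mono) (auto simp: push_def)
    also have "\<dots> = (1 - p) * V.iter (Suc m) n t + p * ((1 - p) * iter m n s)
        + (1 - p) * p * iter m (n - 1) s"
      by (simp add: algebra_simps)
    also have "\<dots> \<le> (1 - p) * V.iter (Suc m) n t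
        + p * (V.iter (Suc m) n t + p * iter m (n - 1) s) + (1 - p) * p * iter m (n - 1) s"
      using 2 4 p_nonneg p_less by (intro add_mono mult_left_mono) auto
    also have "\<dots> = V.iter (Suc m) n t + p * iter m (n - 1) s"
      by (simp add: algebra_simps)
    also have "\<dots> \<le> V.iter (Suc m) n t + p * iter (Suc m) (n - 1) t"
      using 5 p_nonneg by (intro add_mono mult_left_mono) auto
    finally show ?thesis .
  qed
  with nonneg s show ?case by (simp add: max_def split: if_splits)
qed

end

text \<open>
  The lower bound on the positions bounds the local times, one index after the other. It also rules out
  a jump: all particles above the first one that takes part would coalesce, and so they would stay
  below a fixed level.
\<close>
lemma solvable_if_one_sided_divergence:
  assumes "competing_paths p w"
    and below: "\<And>T. 0 \<le> T \<Longrightarrow> \<exists>b. filterlim b at_top sequentially \<and>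
      (\<forall>n\<ge>1. \<forall>t m. 0 \<le> t \<longrightarrow> t \<le> T \<longrightarrow> b n \<le> w n t - local_time_iter 0 w m n t)"
  shows "solvable_competing_paths p w"
proof -
  interpret competing_paths p w by fact
  have below': "\<exists>b. filterlim b at_top sequentially \<and>
      (\<forall>n\<ge>1. \<forall>t m. 0 \<le> t \<longrightarrow> t \<le> T \<longrightarrow> b n \<le> w n t + p * iter m (n - 1) t - (1 - p) * iter m n t)"
    if T: "0 \<le> T" for T
  proof -
    obtain b where b: "filterlim b at_top sequentially"
      "\<And>n t m. 1 \<le> n \<Longrightarrow> 0 \<le> t \<Longrightarrow> t \<le> T \<Longrightarrow> b n \<le> w n t - local_time_iter 0 w m n t"
      using below[OF T] by blast
    have "b n \<le> w n t + p * iter m (n - 1) t - (1 - p) * iter m n t"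
      if "1 \<le> n" "0 \<le> t" "t \<le> T" for n t m
      using b(2)[OF that, of m] iter_le_one_sided[OF that(1,2), of m] by linarith
    with b(1) show ?thesis by blast
  qed
  interpret bounded_competing_paths p w
  proof
    fix j and t :: real assume t: "0 \<le> t"
    obtain b where b: "\<And>n m. 1 \<le> n \<Longrightarrow> b n \<le> w n t + p * iter m (n - 1) t - (1 - p) * iter m n t"
      using below'[OF t] t by auto
    show "\<exists>K. \<forall>m. iter m j t \<le> K"
    proof (induction j)
      case 0
      then show ?case by auto
    next
      case (Suc j)
      then obtain K where K: "\<And>m. iter m j t \<le> K" by auto
      have "iter m (Suc j) t \<le> (w (Suc j) t + p * K - b (Suc j)) / (1 - p)" for m
        using b[of "Suc j" m] mult_left_mono[OF K[of m] p_nonneg] p_less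
        by (simp add: field_simps)
      then show ?case by blast
    qed
  qed
  show ?thesis
  proof
    fix j s assume s: "(0::real) \<le> s"
    show "jump s j = 0"
    proof (rule ccontr)
      assume "jump s j \<noteq> 0"
      then obtain k where k: "1 \<le> k" "0 < jump s k" "\<And>i. i < k \<Longrightarrow> jump s i = 0"
        using first_jump[OF s] by blast
      have step: "jump s (k + n) \<le> jump s (k + Suc n)" for n
      proof -
        have "0 \<le> (p / (1 - p)) ^ Suc n * jump s k"
          using k(2) p_nonneg p_less by (intro mult_nonneg_nonneg zero_le_power) auto
        also have "\<dots> \<le> jump s (k + Suc n) - jump s (k + Suc n - 1)"
          by (rule jump_growth[OF s k(3) k(1)])
        finally show ?thesis by simp
      qed
      have jump_pos: "0 < jump s (k + n)" for n
        by (induction n) (use k(2) step in \<open>auto intro: less_le_trans\<close>)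
      \<comment> \<open>\<open>\<xi> i\<close> is the position of particle \<open>i\<close> right after time \<open>s\<close>.\<close>
      define \<xi> where "\<xi> i = w i s + p * L_right (i - 1) s - (1 - p) * L_right i s" for i
      have "\<xi> (k + n) \<le> \<xi> k" for n
      proof (induction n)
        case (Suc n)
        have "\<xi> (Suc (k + n)) \<le> \<xi> (k + n)"
          using jump_coalesce[OF s _ jump_pos[of n]] k(1) by (simp add: \<xi>_def)
        with Suc show ?case by simp
      qed simp
      obtain b where b: "filterlim b at_top sequentially"
        "\<And>n t m. 1 \<le> n \<Longrightarrow> 0 \<le> t \<Longrightarrow> t \<le> s + 1 \<Longrightarrow>
          b n \<le> w n t + p * iter m (n - 1) t - (1 - p) * iter m n t"
        using below'[of "s + 1"] s by auto
      have bX: "b n \<le> X n t" if "1 \<le> n" "0 \<le> t" "t \<le> s + 1" for n t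
      proof (rule LIMSEQ_le_const)
        show "(\<lambda>m. w n t + p * iter m (n - 1) t - (1 - p) * iter m n t) \<longlonglongrightarrow> X n t"
          unfolding X_def by (intro tendsto_intros iter_tendsto_L that)
        show "\<exists>N. \<forall>m\<ge>N. b n \<le> w n t + p * iter m (n - 1) t - (1 - p) * iter m n t"
          using b(2)[OF that] by auto
      qed
      have b\<xi>: "b n \<le> \<xi> n" if "1 \<le> n" for n
      proof (rule tendsto_lowerbound)
        show "(X n \<longlongrightarrow> \<xi> n) (at_right s)"
          unfolding X_def[abs_def] \<xi>_def
          using that s by (intro tendsto_intros L_tendsto_L_right w_tendsto_right) auto
        show "\<forall>\<^sub>F t in at_right s. b n \<le> X n t"
          using bX[OF that] s by (auto simp: eventually_at_right_field intro!: exI[of _ "s + 1"])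
      qed simp
      have "\<forall>\<^sub>F n in sequentially. \<xi> k + 1 \<le> b n"
        using b(1) by (auto simp: filterlim_at_top)
      then obtain N where N: "\<And>n. N \<le> n \<Longrightarrow> \<xi> k + 1 \<le> b n" by (auto simp: eventually_sequentially)
      show False
        using N[of "k + N"] b\<xi>[of "k + N"] \<open>\<xi> (k + N) \<le> \<xi> k\<close> k(1) by simp
    qed
  qed
qed

section \<open>The one-sided system as a passage problem\<close>

text \<open>
  For \<open>p = 0\<close> the iteration unfolds: particle \<open>j\<close> was last pushed by particle \<open>j + 1\<close> at some time
  \<open>s \<le> t\<close>, that one by particle \<open>j + 2\<close> at a time before \<open>s\<close>, and so on up to a particle \<open>n\<close> that was
  not pushed at all. The sequence \<open>\<sigma>\<close> records these times; it is extended by the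
  value \<open>t\<close> below index \<open>j\<close>, which adds zero terms to the sum.
\<close>
lemma (in competing_paths) one_sided_passage:
  assumes "p = 0" "1 \<le> j" "0 \<le> t"
  shows "\<exists>n\<ge>j. \<exists>\<sigma>. (\<forall>i. 0 \<le> \<sigma> i \<and> \<sigma> i \<le> t \<and> \<sigma> (Suc i) \<le> \<sigma> i) \<and> (\<forall>i<j. \<sigma> i = t) \<and> \<sigma> n = 0 \<and>
    w j t - iter m j t = w n 0 + (\<Sum>i=1..n. w i (\<sigma> (i - 1)) - w i (\<sigma> i))"
  using assms(2,3)
proof (induction m arbitrary: j t)
  have untouched: "\<exists>n\<ge>j. \<exists>\<sigma>. (\<forall>i. 0 \<le> \<sigma> i \<and> \<sigma> i \<le> t \<and> \<sigma> (Suc i) \<le> \<sigma> i) \<and> (\<forall>i<j. \<sigma> i = t) \<and>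
      \<sigma> n = 0 \<and> w j t = w n 0 + (\<Sum>i=1..n. w i (\<sigma> (i - 1)) - w i (\<sigma> i))"
    if "1 \<le> j" "0 \<le> t" for j and t :: real
  proof -
    let ?\<sigma> = "\<lambda>i. if i < j then t else 0"
    have "(\<Sum>i=1..j. w i (?\<sigma> (i - 1)) - w i (?\<sigma> i)) = (\<Sum>i=1..j. if i = j then w j t - w j 0 else 0)"
      by (intro sum.cong) auto
    also have "\<dots> = w j t - w j 0" using that by (simp add: sum.delta)
    finally show ?thesis
      using that by (intro exI[of _ j] conjI exI[of _ ?\<sigma>]) auto
  qed
  {
    case 0
    with untouched[OF 0] show ?case by simp
  next
    case (Suc m)
    obtain s where s: "s \<in> {0..t}" "iter (Suc m) j t = max 0 (push m j s)"
      using running_max_attained[OF continuous_push, of j t m] Suc.prems by (auto simp: iter_Suc)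
    show ?case
    proof (cases "push m j s \<le> 0")
      case True
      with s untouched[OF Suc.prems] show ?thesis by simp
    next
      case False
      obtain n \<sigma> where n: "n \<ge> Suc j"
        and \<sigma>: "\<And>i. 0 \<le> \<sigma> i \<and> \<sigma> i \<le> s \<and> \<sigma> (Suc i) \<le> \<sigma> i" "\<And>i. i < Suc j \<Longrightarrow> \<sigma> i = s" "\<sigma> n = 0"
        and eq: "w (Suc j) s - iter m (Suc j) s = w n 0 + (\<Sum>i=1..n. w i (\<sigma> (i - 1)) - w i (\<sigma> i))"
        using Suc.IH[of "Suc j" s] s by auto
      define \<tau> where "\<tau> i = (if i < j then t else \<sigma> i)" for i
      have "(\<Sum>i=1..n. w i (\<tau> (i - 1)) - w i (\<tau> i))
          = (\<Sum>i=1..n. (w i (\<sigma> (i - 1)) - w i (\<sigma> i)) + (if i = j then w j t - w j s else 0))"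
        by (intro sum.cong) (auto simp: \<tau>_def \<sigma>(2))
      also have "\<dots> = (\<Sum>i=1..n. w i (\<sigma> (i - 1)) - w i (\<sigma> i)) + (w j t - w j s)"
        using n Suc.prems by (simp add: sum.distrib sum.delta)
      finally have sum: "(\<Sum>i=1..n. w i (\<tau> (i - 1)) - w i (\<tau> i))
          = (\<Sum>i=1..n. w i (\<sigma> (i - 1)) - w i (\<sigma> i)) + (w j t - w j s)" .
      have "w j t - iter (Suc m) j t = w n 0 + (\<Sum>i=1..n. w i (\<tau> (i - 1)) - w i (\<tau> i))"
        unfolding sum
      proof -
        have "push m j s = w j s - w (Suc j) s + iter m (Suc j) s"
          unfolding push_def using \<open>p = 0\<close> by simp
        with eq s False show "w j t - iter (Suc m) j t
            = w n 0 + ((\<Sum>i=1..n. w i (\<sigma> (i - 1)) - w i (\<sigma> i)) + (w j t - w j s))"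
          by auto
      qed
      moreover have "0 \<le> \<tau> i \<and> \<tau> i \<le> t \<and> \<tau> (Suc i) \<le> \<tau> i" for i
        using \<sigma>(1)[of i] \<sigma>(1)[of "Suc i"] s Suc.prems by (auto simp: \<tau>_def)
      moreover have "\<tau> n = 0" using \<sigma>(3) n by (simp add: \<tau>_def)
      ultimately show ?thesis
        using n by (intro exI[of _ n] conjI exI[of _ \<tau>]) (auto simp: \<tau>_def)
    qed
  }
qed

definition passage_bound :: "(nat \<Rightarrow> real \<Rightarrow> real) \<Rightarrow> real \<Rightarrow> nat \<Rightarrow> real \<Rightarrow> bool" where
  "passage_bound b T n u \<longleftrightarrow> (\<forall>\<sigma>. antimono \<sigma> \<and> range \<sigma> \<subseteq> {0..T} \<longrightarrow>
     \<bar>\<Sum>i=1..n. b i (\<sigma> (i - 1)) - b i (\<sigma> i)\<bar> \<le> u)"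

lemma passage_bound_mono: "T \<le> T' \<Longrightarrow> passage_bound b T' n u \<Longrightarrow> passage_bound b T n u"
  unfolding passage_bound_def by (meson atLeastatMost_subset_iff order_refl order_trans)

lemma bounded_path:
  fixes f :: "real \<Rightarrow> real"
  assumes "continuous_on {0..} f"
  shows "\<exists>S. \<forall>t\<in>{0..T}. \<bar>f t\<bar> \<le> S"
proof -
  have "continuous_on {0..T} f" by (rule continuous_on_subset[OF assms]) auto
  then have "compact (f ` {0..T})" by (rule compact_continuous_image) auto
  then have "bounded (f ` {0..T})" by (rule compact_imp_bounded)
  then show ?thesis by (auto simp: bounded_iff)
qed

text \<open>
  The drift contributes at most \<open>G T\<close> because the times decrease. Only finitely many particles are below
  the threshold after which the initial positions dominate, and they contribute a bounded amount.
\<close>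
lemma one_sided_divergence_if_passage_bound:
  fixes x g :: "nat \<Rightarrow> real" and b :: "nat \<Rightarrow> real \<Rightarrow> real"
  defines "w \<equiv> (\<lambda>j t. x j + g j * t + b j t)"
  assumes cp: "competing_paths 0 w"
    and b: "\<And>j. 1 \<le> j \<Longrightarrow> continuous_on {0..} (b j)" "\<And>j. 1 \<le> j \<Longrightarrow> b j 0 = 0"
    and g: "\<And>j. 1 \<le> j \<Longrightarrow> \<bar>g j\<bar> \<le> G"
    and a: "0 < a" and x: "\<forall>\<^sub>F n in sequentially. real n powr a < x n"
    and T: "0 \<le> T" and passage: "\<forall>\<^sub>F n in sequentially. passage_bound b T n (real n powr a / 2)"
  shows "\<exists>c. filterlim c at_top sequentially \<and>
    (\<forall>n\<ge>1. \<forall>t m. 0 \<le> t \<longrightarrow> t \<le> T \<longrightarrow> c n \<le> w n t - local_time_iter 0 w m n t)"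
proof -
  interpret competing_paths 0 w by (rule cp)
  obtain N where N: "\<And>n. N \<le> n \<Longrightarrow> real n powr a < x n"
      "\<And>n. N \<le> n \<Longrightarrow> passage_bound b T n (real n powr a / 2)"
    using eventually_conj[OF x passage] by (auto simp: eventually_sequentially)
  have "\<exists>S. \<forall>t\<in>{0..T}. \<bar>b i t\<bar> \<le> S" if "1 \<le> i" for i
    using bounded_path[OF b(1)[OF that]] .
  then obtain S where S: "\<And>i t. 1 \<le> i \<Longrightarrow> t \<in> {0..T} \<Longrightarrow> \<bar>b i t\<bar> \<le> S i" by metis
  define C where "C = (\<Sum>n<N. \<bar>x n\<bar> + (\<Sum>i=1..n. 2 * S i))"
  have S_nonneg: "0 \<le> S i" if "1 \<le> i" for i using S[OF that, of 0] T by auto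
  \<comment> \<open>From \<open>N\<close> on the initial positions dominate the passage sums; \<open>C\<close> covers the particles before.\<close>
  define c where "c n = (if N \<le> n then real n powr a / 2 else - C) - G * T" for n
  have G: "0 \<le> G" using g[of 1] by auto
  have low: "- C \<le> x n + (\<Sum>i=1..n. b i (\<sigma> (i - 1)) - b i (\<sigma> i))"
    if "n < N" and \<sigma>: "\<And>i. \<sigma> i \<in> {0..T}" for n \<sigma>
  proof -
    have "\<bar>\<Sum>i=1..n. b i (\<sigma> (i - 1)) - b i (\<sigma> i)\<bar> \<le> (\<Sum>i=1..n. 2 * S i)"
    proof (rule order_trans[OF sum_abs], rule sum_mono)
      fix i assume "i \<in> {1..n}"
      then show "\<bar>b i (\<sigma> (i - 1)) - b i (\<sigma> i)\<bar> \<le> 2 * S i"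
        using S[of i "\<sigma> (i - 1)"] S[of i "\<sigma> i"] \<sigma>[of i] \<sigma>[of "i - 1"] by fastforce
    qed
    moreover have "\<bar>x n\<bar> + (\<Sum>i=1..n. 2 * S i) \<le> C"
      unfolding C_def using that(1)
      by (intro member_le_sum[where f = "\<lambda>n. \<bar>x n\<bar> + (\<Sum>i=1..n. 2 * S i)"])
         (auto intro!: add_nonneg_nonneg sum_nonneg S_nonneg)
    ultimately show ?thesis by linarith
  qed
  have high: "real n powr a / 2 \<le> x n + (\<Sum>i=1..n. b i (\<sigma> (i - 1)) - b i (\<sigma> i))"
    if "N \<le> n" and \<sigma>: "antimono \<sigma>" "\<And>i. \<sigma> i \<in> {0..T}" for n \<sigma>
  proof -
    have "\<bar>\<Sum>i=1..n. b i (\<sigma> (i - 1)) - b i (\<sigma> i)\<bar> \<le> real n powr a / 2"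
      using N(2)[OF that(1)] \<sigma> by (auto simp: passage_bound_def)
    with N(1)[OF that(1)] show ?thesis by linarith
  qed
  have C: "0 \<le> C" unfolding C_def by (intro sum_nonneg add_nonneg_nonneg) (auto intro: S_nonneg)
  have "c j \<le> w j t - iter m j t" if j: "1 \<le> j" and t: "0 \<le> t" "t \<le> T" for j t m
  proof -
    obtain n \<sigma> where n: "j \<le> n"
      and \<sigma>: "\<And>i. 0 \<le> \<sigma> i \<and> \<sigma> i \<le> t \<and> \<sigma> (Suc i) \<le> \<sigma> i" "\<sigma> n = 0"
      and eq: "w j t - iter m j t = w n 0 + (\<Sum>i=1..n. w i (\<sigma> (i - 1)) - w i (\<sigma> i))"
      using one_sided_passage[OF refl j t(1), of m] by auto
    have anti: "antimono \<sigma>" by (rule decseq_SucI) (use \<sigma> in auto)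
    have range: "\<sigma> i \<in> {0..T}" for i using \<sigma>(1)[of i] t by auto
    have "\<bar>\<Sum>i=1..n. g i * (\<sigma> (i - 1) - \<sigma> i)\<bar> \<le> (\<Sum>i=1..n. G * (\<sigma> (i - 1) - \<sigma> i))"
    proof (rule order_trans[OF sum_abs], rule sum_mono)
      fix i assume i: "i \<in> {1..n}"
      then have "0 \<le> \<sigma> (i - 1) - \<sigma> i" using \<sigma>(1)[of "i - 1"] by simp
      then show "\<bar>g i * (\<sigma> (i - 1) - \<sigma> i)\<bar> \<le> G * (\<sigma> (i - 1) - \<sigma> i)"
        using g[of i] i by (auto simp: abs_mult intro!: mult_mono)
    qed
    also have "\<dots> = G * (\<sigma> 0 - \<sigma> n)"
      unfolding sum_distrib_left[symmetric] by (induction n) auto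
    also have "\<dots> \<le> G * T" using range[of 0] \<sigma>(2) G by (intro mult_left_mono) auto
    finally have drift: "\<bar>\<Sum>i=1..n. g i * (\<sigma> (i - 1) - \<sigma> i)\<bar> \<le> G * T" .
    have "w j t - iter m j t = x n + (\<Sum>i=1..n. b i (\<sigma> (i - 1)) - b i (\<sigma> i))
        + (\<Sum>i=1..n. g i * (\<sigma> (i - 1) - \<sigma> i))"
      unfolding eq using b(2)[of n] j n
      by (simp add: w_def sum.distrib[symmetric] algebra_simps)
    moreover have "c j + G * T \<le> x n + (\<Sum>i=1..n. b i (\<sigma> (i - 1)) - b i (\<sigma> i))"
    proof (cases "N \<le> n")
      case True
      have "real j powr a / 2 \<le> real n powr a / 2"
        using n a by (intro divide_right_mono powr_mono2) auto
      moreover have "- C \<le> real n powr a / 2" using C by (smt (verit) powr_ge_zero divide_nonneg_nonneg)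
      ultimately show ?thesis using high[OF True anti range] by (auto simp: c_def)
    next
      case False
      then show ?thesis using low[OF _ range, of n] n by (auto simp: c_def)
    qed
    ultimately show ?thesis using drift by linarith
  qed
  moreover have "filterlim c at_top sequentially"
  proof (rule filterlim_mono_eventually[where f = "\<lambda>n. real n powr a / 2 - G * T"])
    show "filterlim (\<lambda>n. real n powr a / 2 - G * T) at_top sequentially"
      using a by real_asymp
    show "\<forall>\<^sub>F n in sequentially. real n powr a / 2 - G * T = c n"
      using eventually_ge_at_top[of N] by eventually_elim (simp add: c_def)
  qed auto
  ultimately show ?thesis by blast
qed

section \<open>Adapted solutions from pathwise solutions\<close>

lemma measurable_running_max:
  assumes "\<And>s. 0 \<le> s \<Longrightarrow> s \<le> t \<Longrightarrow> (\<lambda>\<omega>. f \<omega> s) \<in> borel_measurable N" and "0 \<le> t"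
  shows "(\<lambda>\<omega>. running_max (f \<omega>) t) \<in> borel_measurable N"
  unfolding running_max_def
proof (rule borel_measurable_real_SUP)
  show "countable (\<rat> \<inter> {0..1::real})" using countable_rat by blast
  fix u :: real assume "u \<in> \<rat> \<inter> {0..1}"
  then have "(\<lambda>\<omega>. f \<omega> (u * t)) \<in> borel_measurable N"
    using assms(2) by (intro assms(1)) (auto simp: mult_left_le_one_le)
  then show "(\<lambda>\<omega>. max 0 (f \<omega> (u * t))) \<in> borel_measurable N" by measurable
qed

lemma measurable_local_time_iter:
  assumes "\<And>j s. 1 \<le> j \<Longrightarrow> 0 \<le> s \<Longrightarrow> s \<le> t \<Longrightarrow> (\<lambda>\<omega>. w \<omega> j s) \<in> borel_measurable N" and "0 \<le> t"
  shows "(\<lambda>\<omega>. local_time_iter p (w \<omega>) m j t) \<in> borel_measurable N"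
  using assms
proof (induction m arbitrary: j t)
  case 0
  then show ?case by simp
next
  case (Suc m)
  show ?case
  proof (cases "j = 0")
    case True
    then show ?thesis by (simp add: local_time_iter.simps(2))
  next
    case False
    have IH: "(\<lambda>\<omega>. local_time_iter p (w \<omega>) m i s) \<in> borel_measurable N" if "0 \<le> s" "s \<le> t" for i s
      using that by (intro Suc.IH Suc.prems) auto
    have "(\<lambda>\<omega>. running_max (\<lambda>s. w \<omega> j s - w \<omega> (Suc j) s
        + (1 - p) * local_time_iter p (w \<omega>) m (Suc j) s + p * local_time_iter p (w \<omega>) m (j - 1) s) t)
      \<in> borel_measurable N"
      using False
      by (intro measurable_running_max Suc.prems borel_measurable_add borel_measurable_diff
          borel_measurable_times borel_measurable_const IH) auto
    with False show ?thesis by (simp add: local_time_iter.simps(2))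
  qed
qed

lemma measurable_local_time:
  assumes "\<And>j s. 1 \<le> j \<Longrightarrow> 0 \<le> s \<Longrightarrow> s \<le> t \<Longrightarrow> (\<lambda>\<omega>. w \<omega> j s) \<in> borel_measurable N" and "0 \<le> t"
  shows "(\<lambda>\<omega>. local_time p (w \<omega>) j t) \<in> borel_measurable N"
  unfolding local_time_def
  by (intro borel_measurable_real_SUP measurable_local_time_iter assms) auto

text \<open>
  The local times are defined by the same countable limits at every sample point, so they are adapted;
  the almost sure path properties are those of the pathwise solution.
\<close>
lemma strong_solution_if_solvable_paths:
  fixes x :: "nat \<Rightarrow> 'a \<Rightarrow> real" and B :: "nat \<Rightarrow> real \<Rightarrow> 'a \<Rightarrow> real"
  assumes F: "filtered_prob_space M F" and B: "driving_brownian_motions M F B"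
    and x: "initial_sequence M F x"
    and solvable: "AE \<omega> in M. solvable_competing_paths p (\<lambda>j t. x j \<omega> + g j * t + B j t \<omega>)"
  shows "\<exists>X. competing_brownian_particles M F p g x B X"
proof -
  define w where "w \<omega> j t = x j \<omega> + g j * t + B j t \<omega>" for \<omega> j t
  define L where "L j t \<omega> = local_time p (w \<omega>) j t" for j t \<omega>
  define X where "X j t \<omega> = w \<omega> j t + p * L (j - 1) t \<omega> - (1 - p) * L j t \<omega>" for j t \<omega>
  have meas_mono: "f \<in> borel_measurable (F t)" if "f \<in> borel_measurable (F s)" "0 \<le> s" "s \<le> t"
    for f :: "'a \<Rightarrow> real" and s t
  proof -
    have "subalgebra M (F s)" "subalgebra M (F t)"
      using F that unfolding filtered_prob_space_def by (meson order_trans)+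
    moreover have "sets (F s) \<subseteq> sets (F t)"
      using F that unfolding filtered_prob_space_def by blast
    ultimately have "subalgebra (F t) (F s)" by (simp add: subalgebra_def)
    with that(1) show ?thesis by (rule measurable_from_subalg[rotated])
  qed
  have w: "(\<lambda>\<omega>. w \<omega> j s) \<in> borel_measurable (F t)" if "1 \<le> j" "0 \<le> s" "s \<le> t" for j s t
  proof -
    have "x j \<in> borel_measurable (F t)"
    proof (rule meas_mono)
      show "x j \<in> borel_measurable (F 0)" using x that(1) unfolding initial_sequence_def by blast
    qed (use that in auto)
    moreover have "B j s \<in> borel_measurable (F t)"
    proof (rule meas_mono)
      show "B j s \<in> borel_measurable (F s)"
        using B that(1,2) unfolding driving_brownian_motions_def adapted_def by blast
    qed (use that in auto)
    ultimately show ?thesis unfolding w_def by measurable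
  qed
  have L: "adapted F (L j)" for j
    unfolding adapted_def L_def by (intro allI impI measurable_local_time w)
  have X: "adapted F (X j)" if "1 \<le> j" for j
    unfolding adapted_def
  proof (intro allI impI)
    fix t :: real assume t: "0 \<le> t"
    have [measurable]: "L j t \<in> borel_measurable (F t)" "L (j - 1) t \<in> borel_measurable (F t)"
      "(\<lambda>\<omega>. w \<omega> j t) \<in> borel_measurable (F t)"
      using L w[OF that t order_refl] t unfolding adapted_def by blast+
    show "X j t \<in> borel_measurable (F t)" unfolding X_def by measurable
  qed
  have path: "(\<forall>j\<ge>1. continuous_on {0..} (\<lambda>t. X j t \<omega>)) \<and> (\<forall>j. continuous_on {0..} (\<lambda>t. L j t \<omega>)) \<and>
      P1 p g (\<lambda>j. x j \<omega>) (\<lambda>j t. B j t \<omega>) (\<lambda>j t. X j t \<omega>) (\<lambda>j t. L j t \<omega>) \<and>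
      P2 (\<lambda>j t. X j t \<omega>) \<and> P3 (\<lambda>j t. X j t \<omega>) (\<lambda>j t. L j t \<omega>)"
    if "solvable_competing_paths p (w \<omega>)" for \<omega>
  proof -
    interpret S: solvable_competing_paths p "w \<omega>" by fact
    have L: "L j t \<omega> = S.L j t" for j t
      by (simp add: L_def)
    have X: "X j t \<omega> = S.X j t" for j t
      by (simp add: X_def S.X_def L_def)
    have "P1 p g (\<lambda>j. x j \<omega>) (\<lambda>j t. B j t \<omega>) S.X S.L"
      unfolding P1_def S.X_def w_def by simp
    then show ?thesis
      unfolding L X using S.continuous_X S.continuous_L[OF S.no_jump] S.X_P2 S.X_P3 by blast
  qed
  have AE: "AE \<omega> in M. solvable_competing_paths p (w \<omega>)"
    using solvable by (simp add: w_def[abs_def])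
  show ?thesis
    unfolding competing_brownian_particles_def
  proof (rule exI[of _ X], intro conjI allI impI X)
    show "AE \<omega> in M. \<forall>j\<ge>1. continuous_on {0..} (\<lambda>t. X j t \<omega>)"
      using AE by (rule eventually_mono) (use path in blast)
    show "\<exists>L. (\<forall>j. adapted F (L j)) \<and> (AE \<omega> in M. \<forall>j. continuous_on {0..} (\<lambda>t. L j t \<omega>)) \<and>
      (AE \<omega> in M. P1 p g (\<lambda>j. x j \<omega>) (\<lambda>j t. B j t \<omega>) (\<lambda>j t. X j t \<omega>) (\<lambda>j t. L j t \<omega>) \<and>
        P2 (\<lambda>j t. X j t \<omega>) \<and> P3 (\<lambda>j t. X j t \<omega>) (\<lambda>j t. L j t \<omega>))"
    proof (rule exI[of _ L], intro conjI allI L)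
      show "AE \<omega> in M. \<forall>j. continuous_on {0..} (\<lambda>t. L j t \<omega>)"
        using AE by (rule eventually_mono) (use path in blast)
      show "AE \<omega> in M. P1 p g (\<lambda>j. x j \<omega>) (\<lambda>j t. B j t \<omega>) (\<lambda>j t. X j t \<omega>) (\<lambda>j t. L j t \<omega>) \<and>
          P2 (\<lambda>j t. X j t \<omega>) \<and> P3 (\<lambda>j t. X j t \<omega>) (\<lambda>j t. L j t \<omega>)"
        using AE by (rule eventually_mono) (use path in blast)
    qed
  qed
qed

section \<open>Sub-Gaussian random variables\<close>

context prob_space
begin

definition subgaussian :: "real \<Rightarrow> ('a \<Rightarrow> real) \<Rightarrow> bool" where
  "subgaussian v Y \<longleftrightarrow> Y \<in> borel_measurable M \<and>
     (\<forall>\<theta>. (\<integral>\<^sup>+ \<omega>. ennreal (exp (\<theta> * Y \<omega>)) \<partial>M) \<le> ennreal (exp (\<theta>\<^sup>2 * v / 2)))"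

lemma subgaussian_zero: "subgaussian 0 (\<lambda>_. 0)"
  by (simp add: subgaussian_def emeasure_space_1)

lemma subgaussian_mono: "subgaussian v Y \<Longrightarrow> v \<le> v' \<Longrightarrow> subgaussian v' Y"
  unfolding subgaussian_def
proof (intro conjI allI; elim conjE)
  fix \<theta> :: real assume v: "v \<le> v'"
    and *: "\<forall>\<theta>. (\<integral>\<^sup>+ \<omega>. ennreal (exp (\<theta> * Y \<omega>)) \<partial>M) \<le> ennreal (exp (\<theta>\<^sup>2 * v / 2))"
  have "exp (\<theta>\<^sup>2 * v / 2) \<le> exp (\<theta>\<^sup>2 * v' / 2)" using v by (simp add: mult_left_mono)
  then show "(\<integral>\<^sup>+ \<omega>. ennreal (exp (\<theta> * Y \<omega>)) \<partial>M) \<le> ennreal (exp (\<theta>\<^sup>2 * v' / 2))"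
    using * by (meson ennreal_leI order_trans)
qed

text \<open>
  Completing the square turns the exponentially tilted normal density into a shifted one.
\<close>
lemma subgaussian_normal:
  assumes Y: "distributed M lborel Y (normal_density 0 \<sigma>)" and \<sigma>: "0 < \<sigma>"
  shows "subgaussian (\<sigma>\<^sup>2) Y"
  unfolding subgaussian_def
proof (intro conjI allI)
  show "Y \<in> borel_measurable M" using distributed_measurable[OF Y] by simp
  fix \<theta> :: real
  have tilt: "normal_density 0 \<sigma> y * exp (\<theta> * y)
      = exp (\<theta>\<^sup>2 * \<sigma>\<^sup>2 / 2) * normal_density (\<theta> * \<sigma>\<^sup>2) \<sigma> y" for y
  proof -
    have "- y\<^sup>2 / (2 * \<sigma>\<^sup>2) + \<theta> * y = \<theta>\<^sup>2 * \<sigma>\<^sup>2 / 2 + - (y - \<theta> * \<sigma>\<^sup>2)\<^sup>2 / (2 * \<sigma>\<^sup>2)"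
      using \<sigma> by (simp add: field_simps power2_eq_square)
    then have "exp (- y\<^sup>2 / (2 * \<sigma>\<^sup>2)) * exp (\<theta> * y)
        = exp (\<theta>\<^sup>2 * \<sigma>\<^sup>2 / 2) * exp (- (y - \<theta> * \<sigma>\<^sup>2)\<^sup>2 / (2 * \<sigma>\<^sup>2))"
      unfolding exp_add[symmetric] by simp
    then show ?thesis by (simp add: normal_density_def)
  qed
  have "(\<integral>\<^sup>+ \<omega>. ennreal (exp (\<theta> * Y \<omega>)) \<partial>M)
      = (\<integral>\<^sup>+ y. ennreal (normal_density 0 \<sigma> y) * ennreal (exp (\<theta> * y)) \<partial>lborel)"
    by (rule distributed_nn_integral[OF Y, symmetric]) simp
  also have "\<dots> = (\<integral>\<^sup>+ y. ennreal (exp (\<theta>\<^sup>2 * \<sigma>\<^sup>2 / 2)) * ennreal (normal_density (\<theta> * \<sigma>\<^sup>2) \<sigma> y) \<partial>lborel)"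
    by (simp add: ennreal_mult[symmetric] tilt)
  also have "\<dots> = ennreal (exp (\<theta>\<^sup>2 * \<sigma>\<^sup>2 / 2))"
    using \<sigma> by (simp add: nn_integral_cmult nn_integral_eq_integral)
  finally show "(\<integral>\<^sup>+ \<omega>. ennreal (exp (\<theta> * Y \<omega>)) \<partial>M) \<le> ennreal (exp (\<theta>\<^sup>2 * \<sigma>\<^sup>2 / 2))"
    by simp
qed

lemma subgaussian_sum:
  fixes Y :: "'i \<Rightarrow> 'a \<Rightarrow> real"
  assumes I: "finite I" and indep: "indep_vars (\<lambda>_. borel) Y I"
    and sub: "\<And>i. i \<in> I \<Longrightarrow> subgaussian (v i) (Y i)"
  shows "subgaussian (\<Sum>i\<in>I. v i) (\<lambda>\<omega>. \<Sum>i\<in>I. Y i \<omega>)"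
  unfolding subgaussian_def
proof (intro conjI allI)
  show "(\<lambda>\<omega>. \<Sum>i\<in>I. Y i \<omega>) \<in> borel_measurable M"
    using sub by (intro borel_measurable_sum) (auto simp: subgaussian_def)
  fix \<theta> :: real
  have "(\<integral>\<^sup>+ \<omega>. ennreal (exp (\<theta> * (\<Sum>i\<in>I. Y i \<omega>))) \<partial>M)
      = (\<integral>\<^sup>+ \<omega>. (\<Prod>i\<in>I. ennreal (exp (\<theta> * Y i \<omega>))) \<partial>M)"
    using I by (simp add: prod_ennreal exp_sum sum_distrib_left)
  also have "\<dots> = (\<Prod>i\<in>I. \<integral>\<^sup>+ \<omega>. ennreal (exp (\<theta> * Y i \<omega>)) \<partial>M)"
    using I by (intro indep_vars_nn_integral indep_vars_compose2[OF indep]) auto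
  also have "\<dots> \<le> (\<Prod>i\<in>I. ennreal (exp (\<theta>\<^sup>2 * v i / 2)))"
    using sub by (intro prod_mono_ennreal) (auto simp: subgaussian_def)
  also have "\<dots> = ennreal (exp (\<theta>\<^sup>2 * (\<Sum>i\<in>I. v i) / 2))"
    using I by (simp add: prod_ennreal exp_sum[symmetric] sum_distrib_left sum_divide_distrib)
  finally show "(\<integral>\<^sup>+ \<omega>. ennreal (exp (\<theta> * (\<Sum>i\<in>I. Y i \<omega>))) \<partial>M)
      \<le> ennreal (exp (\<theta>\<^sup>2 * (\<Sum>i\<in>I. v i) / 2))" .
qed

text \<open>
  Chernoff's bound for \<open>Y\<close> and \<open>- Y\<close> with the optimal exponent \<open>\<theta> = a / v\<close>.
\<close>
lemma subgaussian_tail: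
  assumes Y: "subgaussian v Y" and v: "0 < v" and a: "0 \<le> a"
  shows "prob {\<omega> \<in> space M. a < \<bar>Y \<omega>\<bar>} \<le> 2 * exp (- a\<^sup>2 / (2 * v))"
proof -
  have Y_meas [measurable]: "Y \<in> borel_measurable M" using Y by (simp add: subgaussian_def)
  have one_sided: "prob {\<omega> \<in> space M. a \<le> \<epsilon> * Y \<omega>} \<le> exp (- a\<^sup>2 / (2 * v))" if \<epsilon>: "\<epsilon>\<^sup>2 = 1" for \<epsilon>
  proof (cases "a = 0")
    case False
    have "emeasure M {\<omega> \<in> space M. a \<le> \<epsilon> * Y \<omega>} \<le> ennreal (exp (- (a / v) * a)) *
        (\<integral>\<^sup>+ \<omega>. ennreal (exp (a / v * (\<epsilon> * Y \<omega>))) * indicator (space M) \<omega> \<partial>M)"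
      using a v False by (intro Chernoff_ineq_nn_integral_ge) auto
    also have "(\<integral>\<^sup>+ \<omega>. ennreal (exp (a / v * (\<epsilon> * Y \<omega>))) * indicator (space M) \<omega> \<partial>M)
        = (\<integral>\<^sup>+ \<omega>. ennreal (exp ((a / v * \<epsilon>) * Y \<omega>)) \<partial>M)"
      by (intro nn_integral_cong) (simp add: mult.assoc)
    also have "ennreal (exp (- (a / v) * a)) * \<dots>
        \<le> ennreal (exp (- (a / v) * a)) * ennreal (exp ((a / v * \<epsilon>)\<^sup>2 * v / 2))"
      using Y unfolding subgaussian_def by (intro mult_left_mono) (blast | simp)+
    also have "\<dots> = ennreal (exp (- a\<^sup>2 / (2 * v)))"
    proof -
      have "- (a / v) * a + (a / v * \<epsilon>)\<^sup>2 * v / 2 = - a\<^sup>2 / (2 * v)"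
        unfolding power_mult_distrib \<epsilon> using v by (simp add: field_simps power2_eq_square)
      then show ?thesis by (simp add: ennreal_mult[symmetric] exp_add[symmetric])
    qed
    finally show ?thesis by (simp add: emeasure_eq_measure)
  qed simp
  have "prob {\<omega> \<in> space M. a < \<bar>Y \<omega>\<bar>}
      \<le> prob ({\<omega> \<in> space M. a \<le> 1 * Y \<omega>} \<union> {\<omega> \<in> space M. a \<le> (-1) * Y \<omega>})"
    by (intro finite_measure_mono) auto
  also have "\<dots> \<le> prob {\<omega> \<in> space M. a \<le> 1 * Y \<omega>} + prob {\<omega> \<in> space M. a \<le> (-1) * Y \<omega>}"
    by (intro measure_Un_le) measurable
  also have "\<dots> \<le> exp (- a\<^sup>2 / (2 * v)) + exp (- a\<^sup>2 / (2 * v))"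
    by (intro add_mono one_sided) auto
  finally show ?thesis by simp
qed

lemma subgaussian_brownian_increment:
  assumes W: "standard_brownian_motion M W" and s: "0 \<le> s" "s \<le> t"
  shows "subgaussian (t - s) (\<lambda>\<omega>. W t \<omega> - W s \<omega>)"
proof (cases "s = t")
  case True
  then show ?thesis using subgaussian_zero by simp
next
  case False
  then have "distributed M lborel (\<lambda>\<omega>. W t \<omega> - W s \<omega>) (normal_density 0 (sqrt (t - s)))"
    using W s by (auto simp: standard_brownian_motion_def)
  from subgaussian_normal[OF this] show ?thesis using False s by simp
qed

end

section \<open>Oscillation of Brownian paths\<close>

text \<open>
  Every dyadic point of level \<open>l + 1\<close> is a dyadic point of level \<open>l\<close>, up to one increment of level \<open>l + 1\<close>.
  Continuity extends the resulting bound from dyadic points to the whole interval.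
\<close>
lemma dyadic_chaining:
  fixes f :: "real \<Rightarrow> real"
  assumes cont: "continuous_on {a..a + h} f" and h: "0 < h"
    and inc: "\<And>l k. k < 2 ^ l \<Longrightarrow>
      \<bar>f (a + real (Suc k) * h / 2 ^ l) - f (a + real k * h / 2 ^ l)\<bar> \<le> u l"
    and u: "\<And>l. 0 \<le> u l" "\<And>l. (\<Sum>i\<le>l. u i) \<le> U"
    and s: "s \<in> {a..a + h}"
  shows "\<bar>f s - f a\<bar> \<le> U"
proof -
  have grid: "\<bar>f (a + real k * h / 2 ^ l) - f a\<bar> \<le> (\<Sum>i\<le>l. u i)" if "k \<le> 2 ^ l" for k l
    using that
  proof (induction l arbitrary: k)
    case 0
    then consider "k = 0" | "k = 1" by fastforce
    then show ?case using inc[of 0 0] u(1)[of 0] by cases auto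
  next
    case (Suc l)
    have even: "a + real (2 * m) * h / 2 ^ Suc l = a + real m * h / 2 ^ l" for m
      by simp
    have "k = 2 * (k div 2) \<or> k = Suc (2 * (k div 2))" by presburger
    then obtain m where "k = 2 * m \<or> k = Suc (2 * m)" by blast
    then show ?case
    proof
      assume k: "k = 2 * m"
      then have "\<bar>f (a + real k * h / 2 ^ Suc l) - f a\<bar> \<le> (\<Sum>i\<le>l. u i)"
        using Suc.IH[of m] Suc.prems even[of m] by simp
      then show ?thesis using u(1)[of "Suc l"] by simp
    next
      assume k: "k = Suc (2 * m)"
      then have "\<bar>f (a + real (2 * m) * h / 2 ^ Suc l) - f a\<bar> \<le> (\<Sum>i\<le>l. u i)"
        using Suc.IH[of m] Suc.prems even[of m] by simp
      moreover have "\<bar>f (a + real k * h / 2 ^ Suc l) - f (a + real (2 * m) * h / 2 ^ Suc l)\<bar> \<le> u (Suc l)"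
        using inc[of "2 * m" "Suc l"] k Suc.prems by simp
      ultimately show ?thesis by simp
    qed
  qed
  \<comment> \<open>The dyadic points \<open>r l\<close> approximate \<open>s\<close> from the left.\<close>
  define k where "k l = nat \<lfloor>(s - a) / h * 2 ^ l\<rfloor>" for l
  define r where "r l = a + real (k l) * h / 2 ^ l" for l
  have k: "k l \<le> 2 ^ l" "real (k l) \<le> (s - a) / h * 2 ^ l" "(s - a) / h * 2 ^ l < real (k l) + 1" for l
  proof -
    have "0 \<le> (s - a) / h * 2 ^ l" using s h by simp
    then show "real (k l) \<le> (s - a) / h * 2 ^ l" "(s - a) / h * 2 ^ l < real (k l) + 1"
      unfolding k_def by linarith+
    have "(s - a) / h * 2 ^ l \<le> 1 * 2 ^ l" using s h by (intro mult_right_mono) auto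
    with \<open>real (k l) \<le> (s - a) / h * 2 ^ l\<close> have "real (k l) \<le> 2 ^ l" by linarith
    then show "k l \<le> 2 ^ l" by simp
  qed
  have r: "r l \<le> s" "s - h / 2 ^ l \<le> r l" "a \<le> r l" for l
  proof -
    have "real (k l) * (h / 2 ^ l) \<le> s - a" "s - a < (real (k l) + 1) * (h / 2 ^ l)"
      using k(2,3)[of l] h by (simp_all add: field_simps)
    then show "r l \<le> s" "s - h / 2 ^ l \<le> r l" by (simp_all add: r_def distrib_right add_divide_distrib)
    show "a \<le> r l" using h by (simp add: r_def)
  qed
  have "r \<longlonglongrightarrow> s"
  proof (rule tendsto_sandwich)
    show "(\<lambda>l. s - h / 2 ^ l) \<longlonglongrightarrow> s" by real_asymp
  qed (use r in \<open>auto intro: tendsto_const\<close>)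
  then have "(\<lambda>l. f (r l)) \<longlonglongrightarrow> f s"
  proof (rule continuous_on_tendsto_compose[OF cont])
    have "r l \<in> {a..a + h}" for l using r(1,3)[of l] s by simp
    then show "\<forall>\<^sub>F l in sequentially. r l \<in> {a..a + h}" by simp
  qed (use s in auto)
  then have "(\<lambda>l. \<bar>f (r l) - f a\<bar>) \<longlonglongrightarrow> \<bar>f s - f a\<bar>" by (intro tendsto_intros)
  then show ?thesis
  proof (rule LIMSEQ_le_const2)
    show "\<exists>N. \<forall>l\<ge>N. \<bar>f (r l) - f a\<bar> \<le> U"
      using grid[OF k(1)] u(2) unfolding r_def by (meson order_trans)
  qed
qed

text \<open>
  The thresholds decrease like \<open>(3/4)\<^sup>l\<close>, more slowly than the standard deviations \<open>2\<^sup>-\<^sup>l\<^sup>/\<^sup>2\<close> of the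
  increments, and the factor \<open>1/4\<close> makes them sum up to \<open>u\<close>.
\<close>
definition oscillation_event :: "'a measure \<Rightarrow> (real \<Rightarrow> 'a \<Rightarrow> real) \<Rightarrow> real \<Rightarrow> real \<Rightarrow> real \<Rightarrow> 'a set" where
  "oscillation_event M W a h u = (\<Union>l. \<Union>k<2 ^ l. {\<omega> \<in> space M.
     u / 4 * (3 / 4) ^ l < \<bar>W (a + real (Suc k) * h / 2 ^ l) \<omega> - W (a + real k * h / 2 ^ l) \<omega>\<bar>})"

lemma bounded_off_oscillation_event:
  assumes \<omega>: "\<omega> \<in> space M" "\<omega> \<notin> oscillation_event M W a h u"
    and cont: "continuous_on {0..} (\<lambda>t. W t \<omega>)" and a: "0 \<le> a" and h: "0 < h" and u: "0 \<le> u"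
    and s: "a \<le> s" "s \<le> a + h"
  shows "\<bar>W s \<omega> - W a \<omega>\<bar> \<le> u"
proof (rule dyadic_chaining[where f = "\<lambda>t. W t \<omega>" and h = h and u = "\<lambda>l. u / 4 * (3 / 4) ^ l"])
  show "continuous_on {a..a + h} (\<lambda>t. W t \<omega>)"
    by (rule continuous_on_subset[OF cont]) (use a in auto)
  show "\<bar>W (a + real (Suc k) * h / 2 ^ l) \<omega> - W (a + real k * h / 2 ^ l) \<omega>\<bar> \<le> u / 4 * (3 / 4) ^ l"
    if "k < 2 ^ l" for l k
    using \<omega> that by (force simp: oscillation_event_def not_less)
  show "(\<Sum>i\<le>l. u / 4 * (3 / 4) ^ i) \<le> u" for l
  proof -
    have "(\<Sum>i\<le>l. u / 4 * (3 / 4) ^ i) = u * (1 - (3 / 4) ^ Suc l)"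
      by (induction l) (auto simp: algebra_simps)
    also have "\<dots> \<le> u * 1" using u by (intro mult_left_mono) auto
    finally show ?thesis by simp
  qed
qed (use h u s in auto)

text \<open>
  With \<open>A = u\<^sup>2 / (32 h)\<close> an increment of level \<open>l\<close> exceeds its threshold with probability at most
  \<open>2 exp (- A (9/8)\<^sup>l)\<close>. For \<open>A \<ge> 24\<close> this is at most \<open>2 exp (- A) 4\<^sup>-\<^sup>l\<close>, which leaves a geometric series
  after summing over the \<open>2\<^sup>l\<close> increments.
\<close>
lemma (in prob_space) oscillation_event:
  assumes W: "standard_brownian_motion M W" and a: "0 \<le> a" and h: "0 < h" and u: "0 \<le> u"
    and large: "24 \<le> u\<^sup>2 / (32 * h)"
  shows sets_oscillation_event: "oscillation_event M W a h u \<in> events"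
    and prob_oscillation_event: "prob (oscillation_event M W a h u) \<le> 4 * exp (- (u\<^sup>2 / (32 * h)))"
proof -
  define A where "A = u\<^sup>2 / (32 * h)"
  let ?I = "\<lambda>l k. {\<omega> \<in> space M. u / 4 * (3 / 4) ^ l
      < \<bar>W (a + real (Suc k) * h / 2 ^ l) \<omega> - W (a + real k * h / 2 ^ l) \<omega>\<bar>}"
  have inc: "subgaussian (h / 2 ^ l) (\<lambda>\<omega>. W (a + real (Suc k) * h / 2 ^ l) \<omega> - W (a + real k * h / 2 ^ l) \<omega>)" for l k
  proof -
    have "(a + real (Suc k) * h / 2 ^ l) - (a + real k * h / 2 ^ l) = h / 2 ^ l"
      by (simp add: field_simps)
    then show ?thesis
      using subgaussian_brownian_increment[OF W, of "a + real k * h / 2 ^ l" "a + real (Suc k) * h / 2 ^ l"] a h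
      by (simp add: divide_right_mono)
  qed
  have I: "?I l k \<in> events" for l k
  proof -
    have [measurable]: "W (a + real k * h / 2 ^ l) \<in> borel_measurable M" for k
      using W a h by (auto simp: standard_brownian_motion_def)
    show ?thesis by measurable
  qed
  have Iprob: "prob (?I l k) \<le> 2 * exp (- A) * (1 / 4) ^ l" for l k
  proof -
    have "prob (?I l k) \<le> 2 * exp (- (u / 4 * (3 / 4) ^ l)\<^sup>2 / (2 * (h / 2 ^ l)))"
      using h u by (intro subgaussian_tail inc) auto
    also have "- (u / 4 * (3 / 4) ^ l)\<^sup>2 / (2 * (h / 2 ^ l)) = - (A * (9 / 8) ^ l)"
    proof -
      have "(9 / 8) ^ l = ((3 / 4) ^ l)\<^sup>2 * (2 ^ l :: real)"
        by (simp add: power_mult_distrib[symmetric] power2_eq_square)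
      moreover have "- (u / 4 * c)\<^sup>2 / (2 * (h / d)) = - (A * (c\<^sup>2 * d))" for c d :: real
        by (simp add: A_def power2_eq_square)
      ultimately show ?thesis by simp
    qed
    also have "\<dots> \<le> - (A * (1 + real l / 8))"
    proof -
      have "1 + real l * (1 / 8) \<le> (1 + 1 / 8 :: real) ^ l" by (rule Bernoulli_inequality) simp
      then show ?thesis using large by (intro le_imp_neg_le mult_left_mono) (auto simp: A_def)
    qed
    also have "exp (- (A * (1 + real l / 8))) = exp (- A) * exp (- A / 8) ^ l"
      by (simp add: exp_of_nat_mult[symmetric] exp_add[symmetric] algebra_simps)
    also have "\<dots> \<le> exp (- A) * (1 / 4) ^ l"
    proof -
      have "exp (- A / 8) \<le> exp (- 3)" using large by (simp add: A_def)
      also have "\<dots> = 1 / exp 3" by (simp add: exp_minus field_simps)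
      also have "\<dots> \<le> 1 / 4" using exp_ge_add_one_self[of 3] by (intro divide_left_mono) auto
      finally show ?thesis by (intro mult_left_mono power_mono) auto
    qed
    finally show ?thesis by simp
  qed
  have level: "(\<Union>k<2 ^ l. ?I l k) \<in> events" for l using I by auto
  show ev: "oscillation_event M W a h u \<in> events"
    unfolding oscillation_event_def using level by auto
  have level_prob: "prob (\<Union>k<2 ^ l. ?I l k) \<le> 2 * exp (- A) * (1 / 2) ^ l" for l
  proof -
    have "prob (\<Union>k<2 ^ l. ?I l k) \<le> (\<Sum>k<2 ^ l. prob (?I l k))"
      using I by (intro finite_measure_subadditive_finite) auto
    also have "\<dots> \<le> (\<Sum>k<(2::nat) ^ l. 2 * exp (- A) * (1 / 4) ^ l)"
      by (intro sum_mono Iprob)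
    also have "\<dots> = 2 * exp (- A) * (1 / 2) ^ l"
      by (simp add: power_divide power_mult_distrib[symmetric] field_simps)
    finally show ?thesis .
  qed
  have geo: "(\<lambda>l. 2 * exp (- A) * (1 / 2) ^ l) sums (2 * exp (- A) * 2)"
    using geometric_sums[of "1 / 2 :: real"] by (intro sums_mult) auto
  have summ: "summable (\<lambda>l. prob (\<Union>k<2 ^ l. ?I l k))"
    by (rule summable_comparison_test'[OF sums_summable[OF geo], of 0]) (use level_prob in auto)
  have "prob (oscillation_event M W a h u) \<le> (\<Sum>l. prob (\<Union>k<2 ^ l. ?I l k))"
    unfolding oscillation_event_def
    by (rule finite_measure_subadditive_countably) (use level summ in auto)
  also have "\<dots> \<le> 2 * exp (- A) * 2"
    using suminf_le[OF level_prob summ sums_summable[OF geo]] sums_unique[OF geo] by simp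
  finally show "prob (oscillation_event M W a h u) \<le> 4 * exp (- (u\<^sup>2 / (32 * h)))"
    by (simp add: A_def)
qed

section \<open>Passage sums of Brownian motions\<close>

text \<open>
  Restricting to \<open>{0..n}\<close> makes this a finite set, so that a union bound applies.
\<close>
definition grid_descents :: "nat \<Rightarrow> (nat \<Rightarrow> nat) set" where
  "grid_descents n = {\<kappa> \<in> {0..n} \<rightarrow>\<^sub>E {0..n}. \<forall>i\<in>{1..n}. \<kappa> i \<le> \<kappa> (i - 1)}"

lemma finite_grid_descents: "finite (grid_descents n)"
  unfolding grid_descents_def
  by (rule finite_subset[OF _ finite_PiE[of "{0..n}" "\<lambda>_. {0..n}"]]) auto

lemma card_grid_descents: "card (grid_descents n) \<le> (n + 1) ^ (n + 1)"
proof -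
  have "card (grid_descents n) \<le> card ({0..n} \<rightarrow>\<^sub>E {0..n})"
    unfolding grid_descents_def by (intro card_mono finite_PiE) auto
  also have "\<dots> = (n + 1) ^ (n + 1)" by (simp add: card_PiE)
  finally show ?thesis .
qed

text \<open>
  Time is cut into \<open>n\<close> cells of length \<open>T / n\<close>. Half of the allowance \<open>u\<close> goes to the passage sum at grid
  times, the other half to rounding: a passage sum involves \<open>2 n\<close> values of the processes, each of
  which may change by \<open>u / (4 n)\<close>.
\<close>
definition passage_event ::
  "'a measure \<Rightarrow> (nat \<Rightarrow> real \<Rightarrow> 'a \<Rightarrow> real) \<Rightarrow> real \<Rightarrow> nat \<Rightarrow> real \<Rightarrow> 'a set" where
  "passage_event M B T n u =
     (\<Union>i\<in>{1..n}. \<Union>k\<in>{0..n}. oscillation_event M (B i) (real k * (T / n)) (T / n) (u / (4 * n))) \<union>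
     (\<Union>\<kappa>\<in>grid_descents n. {\<omega> \<in> space M. u / 2
        < \<bar>\<Sum>i=1..n. B i (real (\<kappa> (i - 1)) * (T / n)) \<omega> - B i (real (\<kappa> i) * (T / n)) \<omega>\<bar>})"

lemma passage_bound_off_passage_event:
  assumes \<omega>: "\<omega> \<in> space M" "\<omega> \<notin> passage_event M B T n u"
    and cont: "\<And>i. 1 \<le> i \<Longrightarrow> continuous_on {0..} (\<lambda>t. B i t \<omega>)"
    and T: "0 < T" and n: "1 \<le> n" and u: "0 \<le> u"
  shows "passage_bound (\<lambda>i t. B i t \<omega>) T n u"
  unfolding passage_bound_def
proof (intro allI impI, elim conjE)
  fix \<sigma> :: "nat \<Rightarrow> real" assume anti: "antimono \<sigma>" and range: "range \<sigma> \<subseteq> {0..T}"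
  define h where "h = T / n"
  have h: "0 < h" "real n * h = T" using T n by (auto simp: h_def)
  define k where "k m = nat \<lfloor>\<sigma> m / h\<rfloor>" for m
  have "\<sigma> m \<in> {0..T}" for m using range by blast
  then have \<sigma>: "0 \<le> \<sigma> m" "\<sigma> m \<le> T" for m by simp_all
  have k: "real (k m) * h \<le> \<sigma> m" "\<sigma> m \<le> real (k m) * h + h" for m
  proof -
    have "0 \<le> \<sigma> m / h" using \<sigma>[of m] h by simp
    then have "real (k m) \<le> \<sigma> m / h" "\<sigma> m / h \<le> real (k m) + 1"
      unfolding k_def by linarith+
    then show "real (k m) * h \<le> \<sigma> m" "\<sigma> m \<le> real (k m) * h + h"
      using h by (simp_all add: field_simps)
  qed
  have kn: "k m \<le> n" for m
  proof -
    have "real (k m) * h \<le> real n * h" using k(1)[of m] \<sigma>(2)[of m] h by linarith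
    then have "real (k m) \<le> real n" using h(1) by (rule mult_right_le_imp_le)
    then show ?thesis by simp
  qed
  have k_anti: "k (Suc m) \<le> k m" for m
    unfolding k_def using antimonoD[OF anti, of m "Suc m"] h
    by (intro nat_mono floor_mono divide_right_mono) auto
  define \<kappa> where "\<kappa> = restrict k {0..n}"
  have \<kappa>: "\<kappa> \<in> grid_descents n"
  proof -
    have "k i \<le> k (i - 1)" if "i \<in> {1..n}" for i using k_anti[of "i - 1"] that by simp
    then show ?thesis unfolding grid_descents_def \<kappa>_def using kn by auto
  qed
  \<comment> \<open>The error of replacing the time \<open>\<sigma> m\<close> by the grid point to its left.\<close>
  define e where "e i m = B i (\<sigma> m) \<omega> - B i (real (k m) * h) \<omega>" for i m
  have e: "\<bar>e i m\<bar> \<le> u / (4 * n)" if "i \<in> {1..n}" for i m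
    unfolding e_def
  proof (rule bounded_off_oscillation_event[where W = "B i" and h = h])
    show "\<omega> \<notin> oscillation_event M (B i) (real (k m) * h) h (u / (4 * n))"
      using \<omega>(2) that kn[of m] unfolding passage_event_def h_def by auto
    show "continuous_on {0..} (\<lambda>t. B i t \<omega>)" using cont that by simp
  qed (use \<omega>(1) h k u in auto)
  have grid: "\<bar>\<Sum>i=1..n. B i (real (k (i - 1)) * h) \<omega> - B i (real (k i) * h) \<omega>\<bar> \<le> u / 2"
  proof -
    have "(\<Sum>i=1..n. B i (real (k (i - 1)) * h) \<omega> - B i (real (k i) * h) \<omega>)
        = (\<Sum>i=1..n. B i (real (\<kappa> (i - 1)) * h) \<omega> - B i (real (\<kappa> i) * h) \<omega>)"
      by (intro sum.cong) (auto simp: \<kappa>_def)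
    moreover have "\<bar>\<Sum>i=1..n. B i (real (\<kappa> (i - 1)) * h) \<omega> - B i (real (\<kappa> i) * h) \<omega>\<bar> \<le> u / 2"
      using \<omega> \<kappa> unfolding passage_event_def h_def by force
    ultimately show ?thesis by simp
  qed
  have "\<bar>\<Sum>i=1..n. e i (i - 1) - e i i\<bar> \<le> (\<Sum>i=1..n. 2 * (u / (4 * n)))"
  proof (rule order_trans[OF sum_abs], rule sum_mono)
    fix i assume "i \<in> {1..n}"
    from e[OF this, of i] e[OF this, of "i - 1"]
    show "\<bar>e i (i - 1) - e i i\<bar> \<le> 2 * (u / (4 * n))" by linarith
  qed
  also have "\<dots> = u / 2" using n by simp
  finally have error: "\<bar>\<Sum>i=1..n. e i (i - 1) - e i i\<bar> \<le> u / 2" .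
  have "(\<Sum>i=1..n. B i (\<sigma> (i - 1)) \<omega> - B i (\<sigma> i) \<omega>)
      = (\<Sum>i=1..n. B i (real (k (i - 1)) * h) \<omega> - B i (real (k i) * h) \<omega>) + (\<Sum>i=1..n. e i (i - 1) - e i i)"
    unfolding sum.distrib[symmetric] by (intro sum.cong) (auto simp: e_def)
  then show "\<bar>\<Sum>i=1..n. B i (\<sigma> (i - 1)) \<omega> - B i (\<sigma> i) \<omega>\<bar> \<le> u"
    using grid error by linarith
qed

lemma inverse_squares_summable: "summable (\<lambda>n. 1 / (real n)\<^sup>2)"
  using inverse_power_summable[of 2, where 'a = real] by (simp add: inverse_eq_divide)

context prob_space
begin

text \<open>
  The summands belong to different Brownian motions, so they are independent, and their
  variances telescope.
\<close>
lemma subgaussian_grid_passage: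
  assumes W: "\<And>i. 1 \<le> i \<Longrightarrow> standard_brownian_motion M (B i)"
    and indep: "indep_vars (\<lambda>_. PiM {0..} (\<lambda>_. borel)) (\<lambda>i \<omega>. \<lambda>t\<in>{0..}. B i t \<omega>) {1..}"
    and h: "0 \<le> h" and \<kappa>: "\<kappa> \<in> grid_descents n"
  shows "subgaussian (real n * h)
    (\<lambda>\<omega>. \<Sum>i=1..n. B i (real (\<kappa> (i - 1)) * h) \<omega> - B i (real (\<kappa> i) * h) \<omega>)"
proof -
  have desc: "\<kappa> i \<le> \<kappa> (i - 1)" if "i \<in> {1..n}" for i using \<kappa> that by (auto simp: grid_descents_def)
  let ?v = "\<lambda>i. real (\<kappa> (i - 1)) * h - real (\<kappa> i) * h"
  have "indep_vars (\<lambda>_. borel)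
      (\<lambda>i \<omega>. (\<lambda>t\<in>{0..}. B i t \<omega>) (real (\<kappa> (i - 1)) * h) - (\<lambda>t\<in>{0..}. B i t \<omega>) (real (\<kappa> i) * h)) {1..n}"
  proof (rule indep_vars_compose2[where Y = "\<lambda>i f. f (real (\<kappa> (i - 1)) * h) - f (real (\<kappa> i) * h)"])
    show "indep_vars (\<lambda>_. PiM {0..} (\<lambda>_. borel)) (\<lambda>i \<omega>. \<lambda>t\<in>{0..}. B i t \<omega>) {1..n}"
      by (rule indep_vars_subset[OF indep]) auto
    have "(\<lambda>f :: real \<Rightarrow> real. f s) \<in> PiM {0..} (\<lambda>_. borel) \<rightarrow>\<^sub>M borel" if "0 \<le> s" for s :: real
      by (rule measurable_component_singleton) (use that in simp)
    then show "(\<lambda>f :: real \<Rightarrow> real. f (real (\<kappa> (i - 1)) * h) - f (real (\<kappa> i) * h)) \<in> PiM {0..} (\<lambda>_. borel) \<rightarrow>\<^sub>M borel" for i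
      using h by (intro borel_measurable_diff) simp_all
  qed
  then have "indep_vars (\<lambda>_. borel) (\<lambda>i \<omega>. B i (real (\<kappa> (i - 1)) * h) \<omega> - B i (real (\<kappa> i) * h) \<omega>) {1..n}"
    using h by simp
  then have "subgaussian (\<Sum>i=1..n. ?v i)
      (\<lambda>\<omega>. \<Sum>i=1..n. B i (real (\<kappa> (i - 1)) * h) \<omega> - B i (real (\<kappa> i) * h) \<omega>)"
  proof (rule subgaussian_sum[rotated])
    fix i assume i: "i \<in> {1..n}"
    show "subgaussian (?v i) (\<lambda>\<omega>. B i (real (\<kappa> (i - 1)) * h) \<omega> - B i (real (\<kappa> i) * h) \<omega>)"
      using i desc[OF i] h by (intro subgaussian_brownian_increment W mult_right_mono) auto
  qed simp
  moreover have "(\<Sum>i=1..n. ?v i) \<le> real n * h"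
  proof -
    have "(\<Sum>i=1..m. ?v i) = (real (\<kappa> 0) - real (\<kappa> m)) * h" for m
      by (induction m) (auto simp: algebra_simps)
    moreover have "\<kappa> 0 \<le> n" using \<kappa> by (auto simp: grid_descents_def)
    ultimately show ?thesis using h by (auto intro!: mult_right_mono)
  qed
  ultimately show ?thesis by (rule subgaussian_mono)
qed

lemma
  assumes W: "\<And>i. 1 \<le> i \<Longrightarrow> standard_brownian_motion M (B i)"
    and indep: "indep_vars (\<lambda>_. PiM {0..} (\<lambda>_. borel)) (\<lambda>i \<omega>. \<lambda>t\<in>{0..}. B i t \<omega>) {1..}"
    and T: "0 < T" and n: "1 \<le> n" and u: "0 \<le> u"
    and large: "24 \<le> (u / (4 * n))\<^sup>2 / (32 * (T / n))"
  shows sets_passage_event: "passage_event M B T n u \<in> events"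
    and prob_passage_event: "prob (passage_event M B T n u)
      \<le> real n * (real n + 1) * (4 * exp (- ((u / (4 * n))\<^sup>2 / (32 * (T / n)))))
        + real (n + 1) ^ (n + 1) * (2 * exp (- (u / 2)\<^sup>2 / (2 * T)))" (is "_ \<le> ?osc + ?grid")
proof -
  let ?O = "\<lambda>i k. oscillation_event M (B i) (real k * (T / n)) (T / n) (u / (4 * n))"
  let ?G = "\<lambda>\<kappa>. {\<omega> \<in> space M. u / 2
      < \<bar>\<Sum>i=1..n. B i (real (\<kappa> (i - 1)) * (T / n)) \<omega> - B i (real (\<kappa> i) * (T / n)) \<omega>\<bar>}"
  have O: "?O i k \<in> events" "prob (?O i k) \<le> 4 * exp (- ((u / (4 * n))\<^sup>2 / (32 * (T / n))))"
    if "i \<in> {1..n}" for i k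
    using oscillation_event[OF W, of i "real k * (T / n)" "T / n" "u / (4 * n)"] that T n u large by auto
  have G_sub: "subgaussian T (\<lambda>\<omega>. \<Sum>i=1..n. B i (real (\<kappa> (i - 1)) * (T / n)) \<omega> - B i (real (\<kappa> i) * (T / n)) \<omega>)"
    if "\<kappa> \<in> grid_descents n" for \<kappa>
    using subgaussian_grid_passage[of B "T / n", OF W indep _ that] T n by simp
  have G: "?G \<kappa> \<in> events" if "\<kappa> \<in> grid_descents n" for \<kappa>
  proof -
    have [measurable]: "(\<lambda>\<omega>. \<Sum>i=1..n. B i (real (\<kappa> (i - 1)) * (T / n)) \<omega> - B i (real (\<kappa> i) * (T / n)) \<omega>)
        \<in> borel_measurable M"
      using G_sub[OF that] by (simp add: subgaussian_def)
    show ?thesis by measurable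
  qed
  have OU: "(\<Union>k\<in>{0..n}. ?O i k) \<in> events" if "i \<in> {1..n}" for i using O that by auto
  have OUU: "(\<Union>i\<in>{1..n}. \<Union>k\<in>{0..n}. ?O i k) \<in> events" using OU by blast
  have GU: "(\<Union>\<kappa>\<in>grid_descents n. ?G \<kappa>) \<in> events" using G finite_grid_descents by blast
  show "passage_event M B T n u \<in> events"
    unfolding passage_event_def using OUU GU by (rule sets.Un)
  have "prob (\<Union>i\<in>{1..n}. \<Union>k\<in>{0..n}. ?O i k) \<le> (\<Sum>i\<in>{1..n}. \<Sum>k\<in>{0..n}. prob (?O i k))"
    using O OU
    by (intro order_trans[OF finite_measure_subadditive_finite] sum_mono finite_measure_subadditive_finite) auto
  also have "\<dots> \<le> (\<Sum>i\<in>{1..n}. \<Sum>k\<in>{0..n}. 4 * exp (- ((u / (4 * n))\<^sup>2 / (32 * (T / n)))))"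
    using O by (intro sum_mono) auto
  also have "\<dots> = ?osc" by simp
  finally have 1: "prob (\<Union>i\<in>{1..n}. \<Union>k\<in>{0..n}. ?O i k) \<le> ?osc" .
  have "prob (\<Union>\<kappa>\<in>grid_descents n. ?G \<kappa>) \<le> (\<Sum>\<kappa>\<in>grid_descents n. prob (?G \<kappa>))"
    using G finite_grid_descents by (intro finite_measure_subadditive_finite) auto
  also have "\<dots> \<le> (\<Sum>\<kappa>\<in>grid_descents n. 2 * exp (- (u / 2)\<^sup>2 / (2 * T)))"
    using u T by (intro sum_mono subgaussian_tail G_sub) auto
  also have "\<dots> = real (card (grid_descents n)) * (2 * exp (- (u / 2)\<^sup>2 / (2 * T)))" by simp
  also have "\<dots> \<le> real ((n + 1) ^ (n + 1)) * (2 * exp (- (u / 2)\<^sup>2 / (2 * T)))"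
    using card_grid_descents[of n] by (intro mult_right_mono of_nat_mono) auto
  finally have 2: "prob (\<Union>\<kappa>\<in>grid_descents n. ?G \<kappa>) \<le> ?grid"
    by (simp only: of_nat_power)
  have "prob (passage_event M B T n u)
      \<le> prob (\<Union>i\<in>{1..n}. \<Union>k\<in>{0..n}. ?O i k) + prob (\<Union>\<kappa>\<in>grid_descents n. ?G \<kappa>)"
    unfolding passage_event_def by (intro measure_Un_le OUU GU)
  with 1 2 show "prob (passage_event M B T n u) \<le> ?osc + ?grid" by linarith
qed

text \<open>
  For \<open>u = n\<^sup>a / 2\<close> the two exponents in \<open>prob_passage_event\<close> are multiples of \<open>n\<^sup>2\<^sup>a\<^sup>-\<^sup>1\<close> and \<open>n\<^sup>2\<^sup>a\<close>.
  As \<open>a > 1/2\<close>, the first one tends to infinity like a power of \<open>n\<close>, and the second one beats the bound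
  \<open>(n + 1) ln (n + 1)\<close> on the logarithm of the number of descents.
\<close>
lemma eventually_passage_bound:
  fixes a T :: real
  assumes W: "\<And>i. 1 \<le> i \<Longrightarrow> standard_brownian_motion M (B i)"
    and indep: "indep_vars (\<lambda>_. PiM {0..} (\<lambda>_. borel)) (\<lambda>i \<omega>. \<lambda>t\<in>{0..}. B i t \<omega>) {1..}"
    and a: "1 / 2 < a" and T: "0 < T"
  shows "AE \<omega> in M. (\<forall>i\<ge>1. continuous_on {0..} (\<lambda>t. B i t \<omega>)) \<longrightarrow>
    (\<forall>\<^sub>F n in sequentially. passage_bound (\<lambda>i t. B i t \<omega>) T n (real n powr a / 2))"
proof -
  define d where "d = 2 * a - 1"
  define u where "u n = real n powr a / 2" for n :: nat
  have d: "0 < d" using a by (simp add: d_def)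
  have square: "(real n powr a)\<^sup>2 = real n powr (1 + d)" for n :: nat
    by (simp add: d_def powr_add[symmetric] power2_eq_square)
  have osc: "(u n / (4 * n))\<^sup>2 / (32 * (T / n)) = 1 / (2048 * T) * real n powr d" if "1 \<le> n" for n :: nat
  proof -
    have "(u n / (4 * n))\<^sup>2 / (32 * (T / n)) = (real n powr a)\<^sup>2 / (2048 * T * n)"
      using that T by (simp add: u_def power_divide field_simps power2_eq_square)
    also have "\<dots> = 1 / (2048 * T) * real n powr d"
      unfolding square powr_add using that by simp
    finally show ?thesis .
  qed
  have grid: "- (u n / 2)\<^sup>2 / (2 * T) = - (1 / (32 * T) * real n powr (1 + d))" for n
    unfolding square[symmetric] by (simp add: u_def power_divide)
  let ?E = "\<lambda>n. passage_event M B T n (u n)"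
  let ?b = "\<lambda>n. real n * (real n + 1) * (4 * exp (- (1 / (2048 * T) * real n powr d)))
    + real (n + 1) ^ (n + 1) * (2 * exp (- (1 / (32 * T) * real n powr (1 + d))))"
  have "\<forall>\<^sub>F n in sequentially. 24 \<le> 1 / (2048 * T) * real n powr d" using d T by real_asymp
  then obtain N where N: "\<And>n. N \<le> n \<Longrightarrow> 24 \<le> 1 / (2048 * T) * real n powr d"
    by (auto simp: eventually_sequentially)
  \<comment> \<open>The tail estimate holds from \<open>N\<close> on, so earlier events are dropped.\<close>
  define A where "A n = (if max 1 N \<le> n then ?E n else {})" for n
  have E: "?E n \<in> events" "prob (?E n) \<le> ?b n" if "max 1 N \<le> n" for n
    using sets_passage_event[OF W indep T, of n "u n"] prob_passage_event[OF W indep T, of n "u n"]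
      N[of n] osc[of n] grid[of n] that by (auto simp: u_def[of n])
  have "?b \<in> O(\<lambda>n. 1 / (real n)\<^sup>2)"
  proof -
    have "(\<lambda>n. real n * (real n + 1) * (4 * exp (- (c * real n powr d)))
        + real (n + 1) ^ (n + 1) * (2 * exp (- (c' * real n powr (1 + d))))) \<in> O(\<lambda>n. 1 / (real n)\<^sup>2)"
      if "0 < c" "0 < c'" for c c' :: real
    proof (rule sum_in_bigo)
      show "(\<lambda>n. real n * (real n + 1) * (4 * exp (- (c * real n powr d)))) \<in> O(\<lambda>n. 1 / (real n)\<^sup>2)"
        using d that by real_asymp
      show "(\<lambda>n. real (n + 1) ^ (n + 1) * (2 * exp (- (c' * real n powr (1 + d))))) \<in> O(\<lambda>n. 1 / (real n)\<^sup>2)"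
        using d that by real_asymp
    qed
    from this[of "1 / (2048 * T)" "1 / (32 * T)"] T show ?thesis by (simp only: zero_less_divide_1_iff mult_pos_pos zero_less_numeral simp_thms)
  qed
  then have "summable ?b"
    by (rule summable_comparison_test_bigo[rotated]) (use inverse_squares_summable in simp)
  have "summable (\<lambda>n. prob (A n))"
  proof (rule summable_comparison_test'[OF \<open>summable ?b\<close>])
    show "norm (prob (A n)) \<le> ?b n" if "0 \<le> n" for n
      using E(2)[of n] by (auto simp: A_def intro!: add_nonneg_nonneg)
  qed
  then have "AE \<omega> in M. \<forall>\<^sub>F n in sequentially. \<omega> \<in> space M - A n"
    using E by (intro borel_cantelli_AE1) (auto simp: A_def less_top[symmetric])
  then show ?thesis
  proof (rule eventually_mono, intro impI)
    fix \<omega> assume ev: "\<forall>\<^sub>F n in sequentially. \<omega> \<in> space M - A n"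
      and cont: "\<forall>i\<ge>1. continuous_on {0..} (\<lambda>t. B i t \<omega>)"
    show "\<forall>\<^sub>F n in sequentially. passage_bound (\<lambda>i t. B i t \<omega>) T n (real n powr a / 2)"
      using ev eventually_ge_at_top[of "max 1 N"]
    proof eventually_elim
      case (elim n)
      then show ?case
        using cont T unfolding u_def[symmetric]
        by (intro passage_bound_off_passage_event[where M = M]) (auto simp: A_def u_def)
    qed
  qed
qed

text \<open>
  The Gaussian tail of the supremum over \<open>[0, T]\<close> is the same for every \<open>j\<close>, and at level \<open>j\<close> it is summable.
\<close>
lemma eventually_linear_growth:
  fixes T :: real
  assumes W: "\<And>i. 1 \<le> i \<Longrightarrow> standard_brownian_motion M (B i)" and T: "0 < T"
  shows "AE \<omega> in M. (\<forall>i\<ge>1. continuous_on {0..} (\<lambda>t. B i t \<omega>) \<and> B i 0 \<omega> = 0) \<longrightarrow>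
    (\<forall>\<^sub>F j in sequentially. \<forall>t\<in>{0..T}. \<bar>B j t \<omega>\<bar> \<le> real j)"
proof -
  have "\<forall>\<^sub>F n in sequentially. 24 \<le> (real n)\<^sup>2 / (32 * T)" using T by real_asymp
  then obtain N where N: "\<And>n. N \<le> n \<Longrightarrow> 24 \<le> (real n)\<^sup>2 / (32 * T)"
    by (auto simp: eventually_sequentially)
  let ?E = "\<lambda>j. oscillation_event M (B j) 0 T (real j)"
  let ?b = "\<lambda>j. 4 * exp (- ((real j)\<^sup>2 / (32 * T)))"
  define A where "A j = (if max 1 N \<le> j then ?E j else {})" for j
  have E: "?E j \<in> events" "prob (?E j) \<le> ?b j" if "max 1 N \<le> j" for j
    using oscillation_event[OF W, of j 0 T "real j"] N[of j] T that by auto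
  have "?b \<in> O(\<lambda>n. 1 / (real n)\<^sup>2)"
    using T by real_asymp
  then have "summable ?b"
    by (rule summable_comparison_test_bigo[rotated]) (use inverse_squares_summable in simp)
  have "summable (\<lambda>n. prob (A n))"
  proof (rule summable_comparison_test'[OF \<open>summable ?b\<close>])
    show "norm (prob (A n)) \<le> ?b n" if "0 \<le> n" for n
      using E(2)[of n] by (auto simp: A_def)
  qed
  then have "AE \<omega> in M. \<forall>\<^sub>F n in sequentially. \<omega> \<in> space M - A n"
    using E by (intro borel_cantelli_AE1) (auto simp: A_def less_top[symmetric])
  then show ?thesis
  proof (rule eventually_mono, intro impI)
    fix \<omega> assume ev: "\<forall>\<^sub>F n in sequentially. \<omega> \<in> space M - A n"
      and path: "\<forall>i\<ge>1. continuous_on {0..} (\<lambda>t. B i t \<omega>) \<and> B i 0 \<omega> = 0"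
    show "\<forall>\<^sub>F j in sequentially. \<forall>t\<in>{0..T}. \<bar>B j t \<omega>\<bar> \<le> real j"
      using ev eventually_ge_at_top[of "max 1 N"]
    proof eventually_elim
      case (elim j)
      then show ?case
        using bounded_off_oscillation_event[of \<omega> M "B j" 0 T "real j"] path T
        by (auto simp: A_def)
    qed
  qed
qed

end

section \<open>Existence of strong solutions\<close>

lemma bounded_if_square_summable:
  assumes "(\<lambda>j. (g j)\<^sup>2) summable_on {1..}"
  shows "\<exists>G :: real. \<forall>j\<ge>1 :: nat. \<bar>g j\<bar> \<le> G"
proof -
  let ?G = "\<Sum>\<^sub>\<infinity>j\<in>{1..}. (g j)\<^sup>2"
  have "\<bar>g j\<bar> \<le> sqrt ?G" if "1 \<le> j" for j
  proof -
    have "(\<Sum>i\<in>{j}. (g i)\<^sup>2) \<le> ?G"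
      using that assms by (intro finite_sum_le_infsum) auto
    then show ?thesis using real_sqrt_le_mono[of "(g j)\<^sup>2" ?G] by simp
  qed
  then show ?thesis by blast
qed

lemma AE_all_brownian_paths:
  assumes "driving_brownian_motions M F B"
  shows "AE \<omega> in M. \<forall>j\<ge>1. continuous_on {0..} (\<lambda>t. B j t \<omega>) \<and> B j 0 \<omega> = 0"
proof -
  have "AE \<omega> in M. \<forall>j\<in>{1..}. continuous_on {0..} (\<lambda>t. B j t \<omega>) \<and> B j 0 \<omega> = 0"
  proof (rule AE_ball_countable')
    fix j :: nat assume "j \<in> {1..}"
    then have "AE \<omega> in M. B j 0 \<omega> = 0 \<and> continuous_on {0..} (\<lambda>t. B j t \<omega>)"
      using assms by (auto simp: driving_brownian_motions_def standard_brownian_motion_def)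
    then show "AE \<omega> in M. continuous_on {0..} (\<lambda>t. B j t \<omega>) \<and> B j 0 \<omega> = 0"
      by (rule eventually_mono) simp
  qed simp
  then show ?thesis by (rule eventually_mono) simp
qed

lemma competing_paths_of_brownian_paths:
  fixes x g :: "nat \<Rightarrow> real" and b :: "nat \<Rightarrow> real \<Rightarrow> real"
  assumes "0 \<le> p" "p < 1" and x: "mono_on {1..} x"
    and b: "\<forall>j\<ge>1. continuous_on {0..} (b j) \<and> b j 0 = 0"
  shows "competing_paths p (\<lambda>j t. x j + g j * t + b j t)"
proof
  show "continuous_on {0..} (\<lambda>t. x j + g j * t + b j t)" if "1 \<le> j" for j
    using b that by (intro continuous_intros) auto
  show "x j + g j * 0 + b j 0 \<le> x (Suc j) + g (Suc j) * 0 + b (Suc j) 0" if "1 \<le> j" for j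
    using b that mono_onD[OF x, of j "Suc j"] by simp
qed (use assms in auto)

text \<open>
  Borel-Cantelli on \<open>M\<close>, where the events \<open>x n \<le> r n\<close> have the probabilities prescribed by the law \<open>\<gamma>\<close>.
\<close>
lemma AE_initial_sequence_growth:
  assumes M: "prob_space M" and x: "\<And>j. 1 \<le> j \<Longrightarrow> x j \<in> borel_measurable M"
    and law: "distr M real_sequences (\<lambda>\<omega>. \<lambda>j\<in>{1..}. x j \<omega>) = \<gamma>"
    and sum: "(\<lambda>k. measure \<gamma> {y \<in> space \<gamma>. y k \<le> r k}) summable_on {1..}"
  shows "AE \<omega> in M. \<forall>\<^sub>F n in sequentially. r n < x n \<omega>"
proof -
  interpret prob_space M by fact
  have meas: "(\<lambda>\<omega>. \<lambda>j\<in>{1..}. x j \<omega>) \<in> M \<rightarrow>\<^sub>M real_sequences"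
    using x by (intro measurable_restrict) auto
  define A where "A n = {\<omega> \<in> space M. 1 \<le> n \<and> x n \<omega> \<le> r n}" for n
  have A: "A n \<in> events" for n
    using x[of n] unfolding A_def by (cases "1 \<le> n") auto
  have prob_A: "prob (A n) = measure \<gamma> {y \<in> space \<gamma>. y n \<le> r n}" if "1 \<le> n" for n
  proof -
    have [measurable]: "(\<lambda>y. y n) \<in> real_sequences \<rightarrow>\<^sub>M borel"
      using that by (intro measurable_component_singleton) auto
    have "{y \<in> space real_sequences. y n \<le> r n} \<in> sets real_sequences" by measurable
    then have "measure (distr M real_sequences (\<lambda>\<omega>. \<lambda>j\<in>{1..}. x j \<omega>)) {y \<in> space real_sequences. y n \<le> r n}
        = prob ((\<lambda>\<omega>. \<lambda>j\<in>{1..}. x j \<omega>) -` {y \<in> space real_sequences. y n \<le> r n} \<inter> space M)"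
      by (rule measure_distr[OF meas])
    also have "(\<lambda>\<omega>. \<lambda>j\<in>{1..}. x j \<omega>) -` {y \<in> space real_sequences. y n \<le> r n} \<inter> space M = A n"
      using that measurable_space[OF meas] by (auto simp: A_def)
    finally show ?thesis unfolding law[symmetric] space_distr by (rule sym)
  qed
  have "(\<lambda>n. prob (A n)) summable_on {1..}"
    using sum by (rule summable_on_cong[THEN iffD1, rotated]) (simp add: prob_A)
  then have "(\<lambda>n. prob (A n)) summable_on UNIV"
    by (rule summable_on_cong_neutral[THEN iffD1, rotated -1]) (auto simp: A_def)
  then have "summable (\<lambda>n. prob (A n))"
    by (simp add: summable_on_UNIV_nonneg_real_iff)
  then have "AE \<omega> in M. \<forall>\<^sub>F n in sequentially. \<omega> \<in> space M - A n"
    using A by (intro borel_cantelli_AE1) (auto simp: less_top[symmetric])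
  then show ?thesis
  proof (rule eventually_mono)
    fix \<omega> assume "\<forall>\<^sub>F n in sequentially. \<omega> \<in> space M - A n"
    then show "\<forall>\<^sub>F n in sequentially. r n < x n \<omega>"
      using eventually_ge_at_top[of 1] by eventually_elim (auto simp: A_def)
  qed
qed

text \<open>
  The initial gaps only help, the drifts differ by a bounded amount, and the finitely many paths that
  do not yet satisfy the growth bound are bounded on \<open>[0, T]\<close>.
\<close>
lemma linear_gaps_if_eventually_linear_growth:
  fixes x g :: "nat \<Rightarrow> real" and b :: "nat \<Rightarrow> real \<Rightarrow> real"
  assumes x: "mono_on {1..} x" and b: "\<And>j. 1 \<le> j \<Longrightarrow> continuous_on {0..} (b j)"
    and g: "\<And>j. 1 \<le> j \<Longrightarrow> \<bar>g j\<bar> \<le> G" and T: "0 \<le> T"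
    and growth: "\<forall>\<^sub>F j in sequentially. \<forall>t\<in>{0..T}. \<bar>b j t\<bar> \<le> real j"
  shows "\<exists>A\<ge>0. \<forall>j\<ge>1. \<forall>t. 0 \<le> t \<longrightarrow> t \<le> T \<longrightarrow>
    (x j + g j * t + b j t) - (x (Suc j) + g (Suc j) * t + b (Suc j) t) \<le> A * real j"
proof -
  obtain N where N: "\<And>j t. N \<le> j \<Longrightarrow> t \<in> {0..T} \<Longrightarrow> \<bar>b j t\<bar> \<le> real j"
    using growth unfolding eventually_sequentially by blast
  have "\<exists>S. \<forall>t\<in>{0..T}. \<bar>b i t\<bar> \<le> S" if "1 \<le> i" for i
    using bounded_path[OF b[OF that]] .
  then obtain S where S: "\<And>i t. 1 \<le> i \<Longrightarrow> t \<in> {0..T} \<Longrightarrow> \<bar>b i t\<bar> \<le> S i" by metis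
  have S_nonneg: "0 \<le> S i" if "1 \<le> i" for i using S[OF that, of 0] T by auto
  define C where "C = 1 + (\<Sum>i=1..N. S i)"
  have C: "1 \<le> C" unfolding C_def using sum_nonneg[of "{1..N}" S] S_nonneg by simp
  have bC: "\<bar>b j t\<bar> \<le> C * real j" if "1 \<le> j" "t \<in> {0..T}" for j t
  proof (cases "N \<le> j")
    case True
    have "1 * real j \<le> C * real j" using C by (intro mult_right_mono) auto
    then show ?thesis using N[OF True that(2)] by linarith
  next
    case False
    then have "S j \<le> (\<Sum>i=1..N. S i)" using that S_nonneg by (intro member_le_sum) auto
    then have "\<bar>b j t\<bar> \<le> C * 1" using S[OF that] by (simp add: C_def)
    also have "\<dots> \<le> C * real j" using C that by (intro mult_left_mono) auto
    finally show ?thesis .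
  qed
  have G: "0 \<le> G" using g[of 1] by auto
  have "(x j + g j * t + b j t) - (x (Suc j) + g (Suc j) * t + b (Suc j) t) \<le> (2 * (G * T) + 3 * C) * real j"
    if j: "1 \<le> j" and t: "0 \<le> t" "t \<le> T" for j t
  proof -
    have "\<bar>g i * t\<bar> \<le> G * T" if "1 \<le> i" for i
      unfolding abs_mult using g[OF that] t G by (intro mult_mono) auto
    from this[of j] this[of "Suc j"] j
    have "g j * t - g (Suc j) * t \<le> 2 * (G * T) * 1" by (simp add: abs_le_iff)
    also have "\<dots> \<le> 2 * (G * T) * real j" using G T j by (intro mult_left_mono) auto
    finally have "g j * t - g (Suc j) * t \<le> 2 * (G * T) * real j" .
    moreover have "x j \<le> x (Suc j)" using mono_onD[OF x, of j "Suc j"] j by simp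
    moreover have "b j t - b (Suc j) t \<le> 3 * C * real j"
    proof -
      have "b j t - b (Suc j) t \<le> C * real j + C * real (Suc j)"
        using bC[of j t] bC[of "Suc j" t] j t by (simp add: abs_le_iff)
      also have "\<dots> \<le> C * real j + C * (2 * real j)"
        using C j by (intro add_left_mono mult_left_mono) auto
      finally show ?thesis by simp
    qed
    ultimately show ?thesis by (simp add: algebra_simps)
  qed
  moreover have "0 \<le> 2 * (G * T) + 3 * C" using G T C by simp
  ultimately show ?thesis by blast
qed

theorem theorem2p10:
  fixes \<gamma> :: "(nat \<Rightarrow> real) measure" and g :: "nat \<Rightarrow> real"
  assumes "prob_space \<gamma>"
    and "sets \<gamma> = sets real_sequences"
    and "AE x in \<gamma>. mono_on {1..} x"
    and "(\<lambda>j. (g j)\<^sup>2) summable_on {1..}"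
  shows
    "(\<forall>p. 0 \<le> p \<and> p < 1/2 \<and>
        (\<exists>chi>1/2. (\<lambda>k. measure \<gamma> {x \<in> space \<gamma>. x k \<le> real k powr chi}) summable_on {1..}) \<longrightarrow>
        strong_solution_exists TYPE('a) p g \<gamma>) \<and>
     (\<forall>p. 1/2 < p \<and> p < 1 \<and>
        (\<exists>c>0. AE x in \<gamma>. (\<lambda>j. exp (- c * (max (x j) 0)\<^sup>2)) summable_on {1..}) \<longrightarrow>
        strong_solution_exists TYPE('a) p g \<gamma>)"
proof (intro conjI allI impI)
  obtain G where G: "\<And>j. 1 \<le> j \<Longrightarrow> \<bar>g j\<bar> \<le> G"
    using bounded_if_square_summable[OF assms(4)] by auto
  fix p :: real
  {
    assume p: "0 \<le> p \<and> p < 1/2 \<and>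
      (\<exists>chi>1/2. (\<lambda>k. measure \<gamma> {x \<in> space \<gamma>. x k \<le> real k powr chi}) summable_on {1..})"
    then obtain chi where chi: "1/2 < chi"
      "(\<lambda>k. measure \<gamma> {x \<in> space \<gamma>. x k \<le> real k powr chi}) summable_on {1..}" by auto
    show "strong_solution_exists TYPE('a) p g \<gamma>"
      unfolding strong_solution_exists_def
    proof (intro allI impI, elim conjE)
      fix M :: "'a measure" and F B x
      assume F: "filtered_prob_space M F" and B: "driving_brownian_motions M F B"
        and x: "initial_sequence M F x" and law: "has_initial_distribution M x \<gamma>"
      interpret prob_space M using F by (simp add: filtered_prob_space_def)
      have x_meas: "x j \<in> borel_measurable M" if "1 \<le> j" for j
        using x F that unfolding initial_sequence_def filtered_prob_space_def
        by (metis measurable_from_subalg order_refl)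
      have growth: "AE \<omega> in M. \<forall>\<^sub>F n in sequentially. real n powr chi < x n \<omega>"
        by (rule AE_initial_sequence_growth[OF prob_space_axioms x_meas])
          (use law chi(2) in \<open>auto simp: has_initial_distribution_def\<close>)
      have mono: "AE \<omega> in M. mono_on {1..} (\<lambda>j. x j \<omega>)"
        using x by (simp add: initial_sequence_def)
      \<comment> \<open>Integer time horizons keep the exceptional set a countable union of null sets.\<close>
      have passage: "AE \<omega> in M. \<forall>N. (\<forall>i\<ge>1. continuous_on {0..} (\<lambda>t. B i t \<omega>)) \<longrightarrow>
          (\<forall>\<^sub>F n in sequentially. passage_bound (\<lambda>i t. B i t \<omega>) (real (Suc N)) n (real n powr chi / 2))"
        unfolding AE_all_countable
        by (intro allI eventually_passage_bound chi)
          (use B in \<open>auto simp: driving_brownian_motions_def\<close>)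
      have "AE \<omega> in M. solvable_competing_paths p (\<lambda>j t. x j \<omega> + g j * t + B j t \<omega>)"
        using growth mono passage AE_all_brownian_paths[OF B]
      proof eventually_elim
        case (elim \<omega>)
        have paths: "competing_paths q (\<lambda>j t. x j \<omega> + g j * t + B j t \<omega>)" if "0 \<le> q" "q < 1" for q
          using that elim(2,4) by (rule competing_paths_of_brownian_paths)
        show ?case
        proof (rule solvable_if_one_sided_divergence)
          show "competing_paths p (\<lambda>j t. x j \<omega> + g j * t + B j t \<omega>)" using p by (intro paths) auto
          fix T :: real assume T: "0 \<le> T"
          obtain N where N: "T \<le> real (Suc N)" by (metis real_arch_simple le_SucI of_nat_le_iff order_trans)
          have "\<forall>\<^sub>F n in sequentially. passage_bound (\<lambda>i t. B i t \<omega>) (real (Suc N)) n (real n powr chi / 2)"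
            using elim(3,4) by blast
          then have "\<forall>\<^sub>F n in sequentially. passage_bound (\<lambda>i t. B i t \<omega>) T n (real n powr chi / 2)"
            by (rule eventually_mono) (use N passage_bound_mono in blast)
          then show "\<exists>b. filterlim b at_top sequentially \<and> (\<forall>n\<ge>1. \<forall>t m. 0 \<le> t \<longrightarrow> t \<le> T \<longrightarrow>
              b n \<le> x n \<omega> + g n * t + B n t \<omega>
                - local_time_iter 0 (\<lambda>j t. x j \<omega> + g j * t + B j t \<omega>) m n t)"
            using elim(1,4) chi(1) G T
            by (intro one_sided_divergence_if_passage_bound[where G = G and a = chi] paths) auto
        qed
      qed
      then show "\<exists>X. competing_brownian_particles M F p g x B X"
        by (rule strong_solution_if_solvable_paths[OF F B x])
    qed
  }
  {
    assume p: "1/2 < p \<and> p < 1 \<and>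
      (\<exists>c>0. AE x in \<gamma>. (\<lambda>j. exp (- c * (max (x j) 0)\<^sup>2)) summable_on {1..})"
    show "strong_solution_exists TYPE('a) p g \<gamma>"
      unfolding strong_solution_exists_def
    proof (intro allI impI, elim conjE)
      fix M :: "'a measure" and F B x
      assume F: "filtered_prob_space M F" and B: "driving_brownian_motions M F B"
        and x: "initial_sequence M F x"
      interpret prob_space M using F by (simp add: filtered_prob_space_def)
      have mono: "AE \<omega> in M. mono_on {1..} (\<lambda>j. x j \<omega>)"
        using x by (simp add: initial_sequence_def)
      have growth: "AE \<omega> in M. \<forall>N. (\<forall>i\<ge>1. continuous_on {0..} (\<lambda>t. B i t \<omega>) \<and> B i 0 \<omega> = 0) \<longrightarrow>
          (\<forall>\<^sub>F j in sequentially. \<forall>t\<in>{0..real (Suc N)}. \<bar>B j t \<omega>\<bar> \<le> real j)"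
        unfolding AE_all_countable
        by (intro allI eventually_linear_growth)
          (use B in \<open>auto simp: driving_brownian_motions_def\<close>)
      have "AE \<omega> in M. solvable_competing_paths p (\<lambda>j t. x j \<omega> + g j * t + B j t \<omega>)"
        using mono growth AE_all_brownian_paths[OF B]
      proof eventually_elim
        case (elim \<omega>)
        show ?case
        proof (rule solvable_if_linear_gaps)
          show "competing_paths p (\<lambda>j t. x j \<omega> + g j * t + B j t \<omega>)"
            using p elim(1,3) by (intro competing_paths_of_brownian_paths) auto
          fix T :: real assume T: "0 \<le> T"
          obtain N where N: "T \<le> real (Suc N)" by (metis real_arch_simple le_SucI of_nat_le_iff order_trans)
          have "\<forall>\<^sub>F j in sequentially. \<forall>t\<in>{0..real (Suc N)}. \<bar>B j t \<omega>\<bar> \<le> real j"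
            using elim(2,3) by blast
          then have "\<forall>\<^sub>F j in sequentially. \<forall>t\<in>{0..T}. \<bar>B j t \<omega>\<bar> \<le> real j"
            by (rule eventually_mono) (use N in auto)
          then show "\<exists>A\<ge>0. \<forall>j\<ge>1. \<forall>t. 0 \<le> t \<longrightarrow> t \<le> T \<longrightarrow>
              x j \<omega> + g j * t + B j t \<omega> - (x (Suc j) \<omega> + g (Suc j) * t + B (Suc j) t \<omega>) \<le> A * real j"
            using elim(1,3) G T by (intro linear_gaps_if_eventually_linear_growth) auto
        qed (use p in auto)
      qed
      then show "\<exists>X. competing_brownian_particles M F p g x B X"
        by (rule strong_solution_if_solvable_paths[OF F B x])
    qed
  }
qed

end
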